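(* Let $\omega\in\mathbb W_d$ be a doubling weight with lower dilation index $i_\omega>0$. Let $\mathcal B$ be a quasi-greedy M-basis of a quasi-Banach space $\mathbb X$. (1) If $\mathcal B$ is partially greedy, then $\mathcal{PG}_q^\omega\hookrightarrow\mathcal G_q^\omega$ for all $q\in(0,\infty]$. (2) If $\mathcal B$ is a Schauder basis with Property (I) and Property (W$^*$), and $\mathcal{PG}_q^\omega\hookrightarrow\mathcal G_q^\omega$ for some $q\in(0,\infty]$, then $\mathcal B$ is partially greedy.
   Context: Spaces and bases. A quasi-Banach space $(\mathbb X,\|\cdot\|)$ over $\mathbb F=\mathbb R$ or $\mathbb C$ is a complete vector space with a quasi-norm: $\|x\|=0$ iff $x=0$; $\|tx\|=|t|\|x\|$; $\|x+y\|\le\kappa(\|x\|+\|y\|)$ for some $\kappa\ge1$. An M-basis (or simply basis) of $\mathbb X$ is a sequence $\mathcal B=(e_n)_{n\ge1}$ for which there are functionals $(e_n^* )\subset\mathbb X^*$ with $e_i^*(e_j)=\delta_{i,j}$; $0<c_1\le\|e_n\|,\|e_n^*\|_*\le c_2<\infty$ for all $n$; $\overline{\mathrm{span}\{e_n\}}=\mathbb X$; and $e_n^*(x)=0$ for all $n$ implies $x=0$. With $S_m(x)=\sum_{n=1}^m e_n^*(x)e_n$, $\mathcal B$ is Schauder if $\sup_m\|S_m\|<\infty$. Errors. Put $\mathrm{supp}(x)=\{n:e_n^*(x)\ne0\}$. A greedy ordering of $x$ is an injective map $\pi:\mathbb N\to\mathbb N$ with $\mathrm{supp}(x)\subset\pi(\mathbb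 N)$ and $|e^*_{\pi(i)}(x)|\ge|e^*_{\pi(j)}(x)|$ whenever $i\le j$. For $m\in\mathbb N$, $\gamma_m(x)=\sup_\pi\|x-\sum_{n=1}^m e^*_{\pi(n)}(x)e_{\pi(n)}\|$ (supremum over greedy orderings of $x$) and $\beta_m(x)=\|x-S_m(x)\|$. $\mathcal B$ is quasi-greedy if there is $C>0$ with $\gamma_m(x)\le C\|x\|$ for all $x\in\mathbb X$, $m\in\mathbb N$; it is partially greedy if there is $C>0$ with $\gamma_m(x)\le C\beta_m(x)$ for all $x\in\mathbb X$, $m\in\mathbb N$. Weights. $\mathbb W$ is the set of sequences $\omega=(\omega(n))_{n\ge1}$ with $0<\omega(1)\le\omega(2)\le\cdots$ and $\omega(n)\to\infty$. $\mathbb W_d$ (doubling weights) is the set of $\omega\in\mathbb W$ for which there is $\theta\ge1$ with $\omega(2n)\le\theta\,\omega(n)$ for all $n$. For $\omega\in\mathbb W$, $\varphi_\omega(M)=\inf_{k\ge1}\omega(Mk)/\omega(k)$ and $i_\omega=\sup_{M>1}\ln\varphi_\omega(M)/\ln M$ ($M$ ranging over integers). Classes. For $0<q<\infty$, $\|x\|_{\mathcal G_q^\omega}=\|x\|+\big[\sum_{n\ge1}(\omega(n)\gamma_n(x))^q\frac1n\big]^{1/q}$, and $\|x\|_{\mathcal G_\infty^\omega}=\|x\|+\sup_{n\ge1}\omega(n)\gamma_n(x)$; $\mathcal G_q^\omega$ is the set of $x\in\mathbb X$ for which this is finite. $\mathcal{PG}_q^\omega$ is defined in the same way with $\beta_n$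 in place of $\gamma_n$. $X\hookrightarrow Y$ means $X\subset Y$ and there is $C>0$ with $\|x\|_Y\le C\|x\|_X$ for all $x\in X$. Democracy functions. For finite $A\subset\mathbb N$ and scalars $\varepsilon=(\varepsilon_n)_{n\in A}$ with $|\varepsilon_n|=1$ for all $n$ (written $|\varepsilon|=1$), $1_{\varepsilon A}=\sum_{n\in A}\varepsilon_ne_n$. Put $h_l(m)=\inf\{\|1_{\varepsilon A}\|:m\le|A|<\infty,|\varepsilon|=1\}$. Let $\mathbb D=\{(m,u)\in\mathbb N\times\mathbb N:m\le u\}$, and $h_{R,l}(m,u)=\sup\{\|1_{\varepsilon A}\|:|A|=m,\ \max A\le u,\ |\varepsilon|=1\}$ for $(m,u)\in\mathbb D$, $h_{R,r}(m,u)=\inf\{\|1_{\varepsilon A}\|:|A|=m,\ \min A>u,\ |\varepsilon|=1\}$ for $(m,u)\in\mathbb N\times\mathbb N$. A function $\psi:\mathbb N\to\mathbb N$ is a characteristic function of $h_{R,l}$ if $\psi(n)\ge n$ for all $n$ and there is $C>0$ with $\sup_{u\ge m}h_{R,l}(m,u)\le C\,h_{R,l}(m,\psi(m))$ for all $m$. Property (I): (i) $\sup_{\ell\in\mathbb N\cup\{0\},\,u\in\mathbb N}h_{R,r}(2^{\ell+1}u,u)/h_{R,r}(2^\ell u,u)<\infty$, and (ii) there are a characteristic function $\psi$ of $h_{R,l}$ and $C>0$ such that $h_{R,r}(u,u)\le C\,h_{R,r}(m,u)$ whenever $u\le\psi(m)$. Property (W$^*$): there are $C_1,C_2>0$ such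 that for every $m\in\mathbb N$ there are $A\subset\{n\in\mathbb N:n\le C_1m\}$ with $|A|=m$ and $|\varepsilon|=1$ such that $\|1_{\varepsilon A}\|\le C_2h_l(m)$. *)

theory Defs
  imports Complex_Main "HOL-Library.Extended_Nonnegative_Real"
begin

text \<open>
  The natural numbers of the source start at 1: a sequence indexed by them is a function on
  \<^typ>\<open>nat\<close> whose value at 0 is irrelevant, and indices are restricted to \<open>{1..}\<close>.
  Quantities that are suprema or infima of norms take values in \<^typ>\<open>ennreal\<close>, so no
  boundedness has to be presupposed.
\<close>

subsection \<open>Weights\<close>

definition weight :: "(nat \<Rightarrow> real) \<Rightarrow> bool" where
  "weight \<omega> \<longleftrightarrow> 0 < \<omega> 1 \<and> mono_on {1..} \<omega> \<and> filterlim \<omega> at_top sequentially"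

definition doubling_weight :: "(nat \<Rightarrow> real) \<Rightarrow> bool" where
  "doubling_weight \<omega> \<longleftrightarrow> weight \<omega> \<and> (\<exists>\<theta>\<ge>1. \<forall>n\<ge>1. \<omega> (2 * n) \<le> \<theta> * \<omega> n)"

definition lower_dilation :: "(nat \<Rightarrow> real) \<Rightarrow> nat \<Rightarrow> real" where
  "lower_dilation \<omega> M = (INF k\<in>{1..}. \<omega> (M * k) / \<omega> k)"

definition lower_dilation_index :: "(nat \<Rightarrow> real) \<Rightarrow> ereal" where
  "lower_dilation_index \<omega> = (SUP M\<in>{1<..}. ereal (ln (lower_dilation \<omega> M) / ln (real M)))"


subsection \<open>Weighted sequence norms and embeddings\<close>

text \<open>Only used for exponents \<open>r > 0\<close>.\<close>

definition ennreal_powr :: "ennreal \<Rightarrow> real \<Rightarrow> ennreal" where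
  "ennreal_powr a r = (if a = top then top else ennreal (enn2real a powr r))"

text \<open>The parameter \<open>q\<close> ranges over \<open>(0, \<infinity>]\<close>, with \<open>top\<close> in the role of \<open>\<infinity>\<close>.\<close>

definition weighted_lq :: "ennreal \<Rightarrow> (nat \<Rightarrow> real) \<Rightarrow> (nat \<Rightarrow> ennreal) \<Rightarrow> ennreal" where
  "weighted_lq q \<omega> a =
     (if q = top then (SUP n\<in>{1..}. ennreal (\<omega> n) * a n)
      else ennreal_powr
        (\<Sum>n. ennreal_powr (ennreal (\<omega> (Suc n)) * a (Suc n)) (enn2real q) / of_nat (Suc n))
        (1 / enn2real q))"

definition embeds :: "'a set \<Rightarrow> ('a \<Rightarrow> ennreal) \<Rightarrow> 'a set \<Rightarrow> ('a \<Rightarrow> ennreal) \<Rightarrow> bool" where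
  "embeds X nX Y nY \<longleftrightarrow> X \<subseteq> Y \<and> (\<exists>C>0. \<forall>x\<in>X. nY x \<le> ennreal C * nX x)"


subsection \<open>Quasi-Banach spaces\<close>

text \<open>
  By Ostrowski's theorem the class \<^class>\<open>real_normed_field\<close> consists, up to isometric
  isomorphism, of \<^typ>\<open>real\<close> and \<^typ>\<open>complex\<close> only.
\<close>

locale quasi_Banach_space = vector_space scale
  for scale :: "'f::real_normed_field \<Rightarrow> 'a::ab_group_add \<Rightarrow> 'a" (infixr "\<cdot>" 75) +
  fixes qnorm :: "'a \<Rightarrow> real"
  assumes qnorm_nonneg: "0 \<le> qnorm x"
    and qnorm_eq_0_iff: "qnorm x = 0 \<longleftrightarrow> x = 0"
    and qnorm_scale: "qnorm (t \<cdot> x) = norm t * qnorm x"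
    and qnorm_triangle: "\<exists>\<kappa>\<ge>1. \<forall>x y. qnorm (x + y) \<le> \<kappa> * (qnorm x + qnorm y)"
    and qnorm_complete:
      "(\<forall>\<epsilon>>0. \<exists>M. \<forall>m\<ge>M. \<forall>n\<ge>M. qnorm (X m - X n) < \<epsilon>) \<Longrightarrow>
         \<exists>l. (\<lambda>n. qnorm (X n - l)) \<longlonglongrightarrow> 0"
begin

definition dual_norm :: "('a \<Rightarrow> 'f) \<Rightarrow> ennreal" where
  "dual_norm f = (SUP x\<in>{x. qnorm x \<le> 1}. ennreal (norm (f x)))"

definition dual_space :: "('a \<Rightarrow> 'f) set" where
  "dual_space = {f. Vector_Spaces.linear (\<cdot>) (*) f \<and> dual_norm f < top}"

definition operator_norm :: "('a \<Rightarrow> 'a) \<Rightarrow> ennreal" where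
  "operator_norm T = (SUP x\<in>{x. qnorm x \<le> 1}. ennreal (qnorm (T x)))"

end


subsection \<open>Bases and approximation errors\<close>

text \<open>
  The coordinate functionals \<open>es n\<close> are a parameter; they are determined by \<open>e\<close>, since they are
  continuous and biorthogonal to a sequence with dense span.
\<close>

locale M_basis = quasi_Banach_space scale qnorm
  for scale :: "'f::real_normed_field \<Rightarrow> 'a::ab_group_add \<Rightarrow> 'a" (infixr "\<cdot>" 75)
    and qnorm :: "'a \<Rightarrow> real" +
  fixes e :: "nat \<Rightarrow> 'a" and es :: "nat \<Rightarrow> 'a \<Rightarrow> 'f"
  assumes functionals: "n \<ge> 1 \<Longrightarrow> es n \<in> dual_space"
    and biorthogonal: "\<lbrakk>i \<ge> 1; j \<ge> 1\<rbrakk> \<Longrightarrow> es i (e j) = (if i = j then 1 else 0)"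
    and seminormalized:
      "\<exists>c1>0. \<exists>c2. \<forall>n\<ge>1. qnorm (e n) \<in> {c1..c2} \<and> dual_norm (es n) \<in> {ennreal c1..ennreal c2}"
    and dense_span: "\<epsilon> > 0 \<Longrightarrow> \<exists>y\<in>span (e ` {1..}). qnorm (x - y) < \<epsilon>"
    and total: "(\<And>n. n \<ge> 1 \<Longrightarrow> es n x = 0) \<Longrightarrow> x = 0"
begin

definition partial_sum :: "nat \<Rightarrow> 'a \<Rightarrow> 'a" where
  "partial_sum m x = (\<Sum>n=1..m. es n x \<cdot> e n)"

definition schauder :: bool where
  "schauder \<longleftrightarrow> (SUP m\<in>{1..}. operator_norm (partial_sum m)) < top"

definition supp :: "'a \<Rightarrow> nat set" where
  "supp x = {n. n \<ge> 1 \<and> es n x \<noteq> 0}"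

definition greedy_ordering :: "'a \<Rightarrow> (nat \<Rightarrow> nat) \<Rightarrow> bool" where
  "greedy_ordering x \<pi> \<longleftrightarrow>
     \<pi> ` {1..} \<subseteq> {1..} \<and> inj_on \<pi> {1..} \<and> supp x \<subseteq> \<pi> ` {1..} \<and>
     (\<forall>i j. 1 \<le> i \<and> i \<le> j \<longrightarrow> norm (es (\<pi> i) x) \<ge> norm (es (\<pi> j) x))"

definition greedy_error :: "nat \<Rightarrow> 'a \<Rightarrow> ennreal" where
  "greedy_error m x =
     (SUP \<pi>\<in>{\<pi>. greedy_ordering x \<pi>}. ennreal (qnorm (x - (\<Sum>n=1..m. es (\<pi> n) x \<cdot> e (\<pi> n)))))"

definition partial_error :: "nat \<Rightarrow> 'a \<Rightarrow> ennreal" where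
  "partial_error m x = ennreal (qnorm (x - partial_sum m x))"

definition quasi_greedy :: bool where
  "quasi_greedy \<longleftrightarrow> (\<exists>C>0. \<forall>x. \<forall>m\<ge>1. greedy_error m x \<le> ennreal (C * qnorm x))"

definition partially_greedy :: bool where
  "partially_greedy \<longleftrightarrow> (\<exists>C>0. \<forall>x. \<forall>m\<ge>1. greedy_error m x \<le> ennreal C * partial_error m x)"


subsection \<open>Approximation classes\<close>

definition G_norm :: "ennreal \<Rightarrow> (nat \<Rightarrow> real) \<Rightarrow> 'a \<Rightarrow> ennreal" where
  "G_norm q \<omega> x = ennreal (qnorm x) + weighted_lq q \<omega> (\<lambda>n. greedy_error n x)"

definition G_class :: "ennreal \<Rightarrow> (nat \<Rightarrow> real) \<Rightarrow> 'a set" where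
  "G_class q \<omega> = {x. G_norm q \<omega> x < top}"

definition PG_norm :: "ennreal \<Rightarrow> (nat \<Rightarrow> real) \<Rightarrow> 'a \<Rightarrow> ennreal" where
  "PG_norm q \<omega> x = ennreal (qnorm x) + weighted_lq q \<omega> (\<lambda>n. partial_error n x)"

definition PG_class :: "ennreal \<Rightarrow> (nat \<Rightarrow> real) \<Rightarrow> 'a set" where
  "PG_class q \<omega> = {x. PG_norm q \<omega> x < top}"

definition PG_embeds_G :: "ennreal \<Rightarrow> (nat \<Rightarrow> real) \<Rightarrow> bool" where
  "PG_embeds_G q \<omega> \<longleftrightarrow> embeds (PG_class q \<omega>) (PG_norm q \<omega>) (G_class q \<omega>) (G_norm q \<omega>)"


subsection \<open>Democracy functions\<close>

definition signed_sum :: "(nat \<Rightarrow> 'f) \<Rightarrow> nat set \<Rightarrow> 'a" where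
  "signed_sum \<epsilon> A = (\<Sum>n\<in>A. \<epsilon> n \<cdot> e n)"

definition unimodular_on :: "nat set \<Rightarrow> (nat \<Rightarrow> 'f) \<Rightarrow> bool" where
  "unimodular_on A \<epsilon> \<longleftrightarrow> (\<forall>n\<in>A. norm (\<epsilon> n) = 1)"

definition h_l :: "nat \<Rightarrow> ennreal" where
  "h_l m = (INF (A, \<epsilon>)\<in>{(A, \<epsilon>). A \<subseteq> {1..} \<and> finite A \<and> m \<le> card A \<and> unimodular_on A \<epsilon>}.
     ennreal (qnorm (signed_sum \<epsilon> A)))"

text \<open>Used for \<open>1 \<le> m \<le> u\<close> only.\<close>

definition h_Rl :: "nat \<Rightarrow> nat \<Rightarrow> ennreal" where
  "h_Rl m u = (SUP (A, \<epsilon>)\<in>{(A, \<epsilon>). A \<subseteq> {1..u} \<and> card A = m \<and> unimodular_on A \<epsilon>}.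
     ennreal (qnorm (signed_sum \<epsilon> A)))"

definition h_Rr :: "nat \<Rightarrow> nat \<Rightarrow> ennreal" where
  "h_Rr m u = (INF (A, \<epsilon>)\<in>{(A, \<epsilon>). A \<subseteq> {u<..} \<and> finite A \<and> card A = m \<and> unimodular_on A \<epsilon>}.
     ennreal (qnorm (signed_sum \<epsilon> A)))"

definition characteristic_function :: "(nat \<Rightarrow> nat) \<Rightarrow> bool" where
  "characteristic_function \<psi> \<longleftrightarrow>
     (\<forall>n\<ge>1. n \<le> \<psi> n) \<and>
     (\<exists>C>0. \<forall>m\<ge>1. (SUP u\<in>{m..}. h_Rl m u) \<le> ennreal C * h_Rl m (\<psi> m))"

text \<open>
  The quotients are well behaved: \<open>h_Rr m u\<close> is neither \<open>0\<close> nor \<open>top\<close> for \<open>m \<ge> 1\<close>, because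
  the norms \<open>dual_norm (es n)\<close> are bounded.
\<close>

definition property_I :: bool where
  "property_I \<longleftrightarrow>
     (SUP (l, u)\<in>UNIV \<times> {1..}. h_Rr (2 ^ (l + 1) * u) u / h_Rr (2 ^ l * u) u) < top \<and>
     (\<exists>\<psi>. characteristic_function \<psi> \<and>
        (\<exists>C>0. \<forall>m\<ge>1. \<forall>u\<ge>1. u \<le> \<psi> m \<longrightarrow> h_Rr u u \<le> ennreal C * h_Rr m u))"

definition property_W_star :: bool where
  "property_W_star \<longleftrightarrow>
     (\<exists>C1>0. \<exists>C2>0. \<forall>m\<ge>1. \<exists>A \<epsilon>.
        A \<subseteq> {n. 1 \<le> n \<and> real n \<le> C1 * real m} \<and> card A = m \<and> unimodular_on A \<epsilon> \<and>
        ennreal (qnorm (signed_sum \<epsilon> A)) \<le> ennreal C2 * h_l m)"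

end

end

theory Submission
  imports Defs
begin

text \<open>
  Part (1) compares the errors index by index. For part (2), let \<open>A = {1..N}\<close> and let \<open>B\<close> be the part
  beyond \<open>N\<close> of the set that Property (W\<open>*\<close>) provides for \<open>m = 2 ^ l * N\<close>; its norm is controlled by
  \<open>h_Rr N N\<close> through Property (I). Applied to the signed sum over \<open>A \<union> B\<close>, the embedding
  bounds \<open>\<omega> m * \<parallel>1\<^sub>A\<parallel>\<close> by a multiple of \<open>\<omega> N * (\<parallel>1\<^sub>A\<parallel> + \<parallel>1\<^sub>B\<parallel>) + \<omega> m * \<parallel>1\<^sub>B\<parallel>\<close>, and for a large
  fixed \<open>l\<close> the positive dilation index lets the term \<open>\<omega> N * \<parallel>1\<^sub>A\<parallel>\<close> be absorbed. Thus initial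
  segments are dominated by later sets of the same size, and the characteristic function in (I)
  extends this to all sets. Finally \<open>x - P\<^sub>A x = y + P\<^sub>D x - P\<^sub>B y\<close> with \<open>y = x - S\<^sub>m x\<close>,
  \<open>B = A - {1..m}\<close> and \<open>D = {1..m} - A\<close>, where \<open>P\<^sub>B y\<close> is a greedy sum of \<open>y\<close> and \<open>P\<^sub>D x\<close> has
  smaller coefficients than \<open>P\<^sub>B y\<close>.
\<close>

subsection \<open>Weights and weighted sequence norms\<close>

text \<open>The obstacle is the quasi-triangle inequality: its constant grows with the number of
  summands, and convexity, the usual way to pass between coefficients and signs, is missing. Uniform
  bounds come from absorption instead: a vector is split into a fixed number of pieces so that a
  quantity \<open>S\<close>, already known to be finite, satisfies \<open>S \<le> a + S / 2\<close>.
  Signed sums are the right test vectors because all their nonzero coefficients tie, so every subset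
  of the support is a greedy set. An ordering may thus remove \<open>B\<close> while the partial
  sums must remove \<open>{1..N}\<close> first. Property W-star keeps the test set inside
  \<open>{1..L}\<close> with \<open>L\<close> comparable to its size, and doubling then compares
  \<open>\<omega> L\<close> with \<open>\<omega> (2 ^ l * N)\<close>; this controls the term in
  which the large weight meets the norm over \<open>B\<close>. The exponent \<open>l\<close> depends
  only on the weight and on the constant of the embedding test, so the loss from iterating the first
  half of Property (I) is a constant independent of \<open>N\<close>.\<close>

lemma ennreal_powr_ennreal: "0 \<le> a \<Longrightarrow> ennreal_powr (ennreal a) r = ennreal (a powr r)"
  by (simp add: ennreal_powr_def)

lemma ennreal_powr_mono:
  assumes "a \<le> b" "0 \<le> r" shows "ennreal_powr a r \<le> ennreal_powr b r"
proof (cases "b = top")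
  case False
  then have "a \<noteq> top" using assms(1) by (auto simp: top_unique)
  moreover have "enn2real a \<le> enn2real b"
    using assms False by (intro enn2real_mono) (auto simp: less_top)
  ultimately show ?thesis using False assms
    by (auto simp: ennreal_powr_def intro!: ennreal_leI powr_mono2)
qed (simp add: ennreal_powr_def)

lemma ennreal_powr_mult:
  assumes "0 < c"
  shows "ennreal_powr (ennreal c * a) r = ennreal (c powr r) * ennreal_powr a r"
proof (cases a rule: ennreal_cases)
  case (real s)
  then show ?thesis using assms
    by (simp add: ennreal_mult[symmetric] ennreal_powr_ennreal powr_mult)
next
  case top
  then show ?thesis using assms by (simp add: ennreal_powr_def ennreal_mult_top)
qed

lemma weighted_lq_mono:
  assumes "\<And>n. n \<ge> 1 \<Longrightarrow> a n \<le> b n"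
  shows "weighted_lq q \<omega> a \<le> weighted_lq q \<omega> b"
proof (cases "q = top")
  case True
  then show ?thesis
    by (auto simp: weighted_lq_def intro!: SUP_subset_mono mult_left_mono assms)
next
  case False
  then show ?thesis
    by (auto simp: weighted_lq_def
        intro!: ennreal_powr_mono suminf_le divide_right_mono_ennreal mult_left_mono assms)
qed

lemma weighted_lq_mult:
  assumes "0 < c" "0 < q"
  shows "weighted_lq q \<omega> (\<lambda>n. ennreal c * a n) = ennreal c * weighted_lq q \<omega> a"
proof (cases "q = top")
  case True
  then show ?thesis
    by (simp add: weighted_lq_def SUP_mult_left_ennreal mult.left_commute)
next
  case False
  define r where "r = enn2real q"
  have r: "r > 0" using assms False by (simp add: r_def enn2real_positive_iff less_top)
  have "(\<Sum>n. ennreal_powr (ennreal (\<omega> (Suc n)) * (ennreal c * a (Suc n))) r / of_nat (Suc n))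
      = (\<Sum>n. ennreal (c powr r) * (ennreal_powr (ennreal (\<omega> (Suc n)) * a (Suc n)) r / of_nat (Suc n)))"
    using assms
    by (simp add: mult.left_commute[of "ennreal (\<omega> _)"] ennreal_powr_mult ennreal_times_divide)
  also have "\<dots> = ennreal (c powr r) * (\<Sum>n. ennreal_powr (ennreal (\<omega> (Suc n)) * a (Suc n)) r / of_nat (Suc n))"
    by (rule ennreal_suminf_cmult)
  finally show ?thesis
    using False r assms
    by (simp add: weighted_lq_def r_def[symmetric] ennreal_powr_mult powr_powr)
qed

section \<open>Growth of weights and a Hardy inequality\<close>

lemma weight_mono: "weight \<omega> \<Longrightarrow> 1 \<le> m \<Longrightarrow> m \<le> n \<Longrightarrow> \<omega> m \<le> \<omega> n"
  by (auto simp: weight_def mono_on_def)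

lemma weight_pos: "weight \<omega> \<Longrightarrow> 1 \<le> n \<Longrightarrow> 0 < \<omega> n"
  using weight_mono[of \<omega> 1 n] by (auto simp: weight_def)

text \<open>A positive supremum yields one \<open>M\<close> with a positive quotient of logarithms.
  Monotonicity keeps every \<open>\<omega> (M * k) / \<omega> k\<close> at least 1, so the real
  infimum is bounded below and positive; a positive logarithm then means that it exceeds 1.\<close>

lemma lower_dilation_growth:
  assumes w: "weight \<omega>" and i: "lower_dilation_index \<omega> > 0"
  obtains M \<phi> where "M > 1" "\<phi> > 1" "\<And>k. k \<ge> 1 \<Longrightarrow> \<phi> * \<omega> k \<le> \<omega> (M * k)"
proof -
  obtain M where M: "M > 1" "0 < ereal (ln (lower_dilation \<omega> M) / ln (real M))"
    using i unfolding lower_dilation_index_def by (auto simp: less_SUP_iff)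
  have ge: "1 \<le> \<omega> (M * k) / \<omega> k" if "k \<ge> 1" for k
    using weight_mono[OF w, of k "M * k"] weight_pos[OF w that] that M(1) by simp
  then have bdd: "bdd_below ((\<lambda>k. \<omega> (M * k) / \<omega> k) ` {1..})"
    by (intro bdd_belowI2[of _ 1]) auto
  have "lower_dilation \<omega> M \<ge> 1"
    unfolding lower_dilation_def by (intro cINF_greatest ge) auto
  moreover have "ln (lower_dilation \<omega> M) > 0"
    using M by (simp add: zero_less_divide_iff)
  ultimately have "lower_dilation \<omega> M > 1" by (simp add: ln_gt_zero_iff)
  moreover have "lower_dilation \<omega> M * \<omega> k \<le> \<omega> (M * k)" if "k \<ge> 1" for k
  proof -
    have "lower_dilation \<omega> M \<le> \<omega> (M * k) / \<omega> k"
      unfolding lower_dilation_def using that by (intro cINF_lower bdd) auto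
    then show ?thesis using weight_pos[OF w that] by (simp add: pos_le_divide_eq)
  qed
  ultimately show thesis using that M(1) by blast
qed

text \<open>Iterating the growth factor \<phi> along powers of \<open>M\<close> beats any
  \<open>T\<close>. Rounding \<open>M ^ j\<close> up to a power of two fits the dyadic form of
  Property (I).\<close>

lemma weight_power_growth:
  assumes w: "weight \<omega>" and i: "lower_dilation_index \<omega> > 0"
  shows "\<exists>l. \<forall>k\<ge>1. T * \<omega> k \<le> \<omega> (2 ^ l * k)"
proof -
  obtain M \<phi> where M: "M > 1" "\<phi> > 1" "\<And>k. k \<ge> 1 \<Longrightarrow> \<phi> * \<omega> k \<le> \<omega> (M * k)"
    using lower_dilation_growth[OF w i] by metis
  have it: "\<phi> ^ j * \<omega> k \<le> \<omega> (M ^ j * k)" if "k \<ge> 1" for j k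
  proof (induction j)
    case (Suc j)
    have "\<phi> ^ Suc j * \<omega> k \<le> \<phi> * \<omega> (M ^ j * k)" using Suc M(2) by simp
    also have "\<dots> \<le> \<omega> (M ^ Suc j * k)" using M(3)[of "M ^ j * k"] M(1) that by (simp add: ac_simps)
    finally show ?case .
  qed simp
  obtain j where j: "T < \<phi> ^ j" using real_arch_pow[OF M(2)] by blast
  obtain l where l: "M ^ j < 2 ^ l" by (metis less_exp)
  have "T * \<omega> k \<le> \<omega> (2 ^ l * k)" if "k \<ge> 1" for k
  proof -
    have "T * \<omega> k \<le> \<phi> ^ j * \<omega> k" using j weight_pos[OF w that] by simp
    also note it[OF that]
    also have "\<omega> (M ^ j * k) \<le> \<omega> (2 ^ l * k)"
      using l that M(1) by (intro weight_mono[OF w]) auto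
    finally show ?thesis .
  qed
  then show ?thesis by blast
qed

lemma doubling_weight_power:
  fixes \<omega> :: "nat \<Rightarrow> real" and n :: nat
  assumes "\<And>n. n \<ge> 1 \<Longrightarrow> \<omega> (2 * n) \<le> \<theta> * \<omega> n" "\<theta> \<ge> 1" "n \<ge> 1"
  shows "\<omega> (2 ^ s * n) \<le> \<theta> ^ s * \<omega> n"
proof (induction s)
  case (Suc s)
  have "\<omega> (2 ^ Suc s * n) \<le> \<theta> * \<omega> (2 ^ s * n)"
    using assms(1)[of "2 ^ s * n"] assms(3) by (simp add: ac_simps)
  also have "\<dots> \<le> \<theta> ^ Suc s * \<omega> n" using mult_left_mono[OF Suc, of \<theta>] assms(2) by (simp add: mult.assoc)
  finally show ?case .
qed simp

text \<open>A discrete Hardy inequality; the induction passes from \<open>N div M\<close> to \<open>N\<close>.\<close>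

lemma weight_hardy:
  assumes w: "weight \<omega>" and i: "lower_dilation_index \<omega> > 0" and r: "r > 0"
  shows "\<exists>C>0. \<forall>N\<ge>1. (\<Sum>n=1..N. \<omega> n powr r / n) \<le> C * \<omega> N powr r"
proof -
  obtain M \<phi> where M: "M > 1" "\<phi> > 1" "\<And>k. k \<ge> 1 \<Longrightarrow> \<phi> * \<omega> k \<le> \<omega> (M * k)"
    using lower_dilation_growth[OF w i] by metis
  define \<rho> where "\<rho> = \<phi> powr r"
  have \<rho>: "\<rho> > 1" using M(2) r by (simp add: \<rho>_def)
  \<comment> \<open>The fixed point of the recursion: the indices up to \<open>N div M\<close> cost
    \<open>C / \<rho>\<close>, the remaining block costs \<open>M\<close>, and together they must
    give \<open>C\<close> again.\<close>
  define C where "C = M / (1 - 1 / \<rho>)"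
  have C: "C > 0" using \<rho> M(1) by (simp add: C_def)
  have CM: "C / \<rho> + M = C" using \<rho> by (simp add: C_def field_simps)
  have "(\<Sum>n=1..N. \<omega> n powr r / n) \<le> C * \<omega> N powr r" if "N \<ge> 1" for N
    using that
  proof (induction N rule: less_induct)
    case (less N)
    define K where "K = N div M"
    have K: "K < N" "M * K \<le> N" "N < M * (K + 1)"
      using less.prems M(1) by (auto simp: K_def dividend_less_times_div)
    have "{1..N} = {1..K} \<union> {K<..N}" using K by auto
    then have "(\<Sum>n=1..N. \<omega> n powr r / n) = (\<Sum>n=1..K. \<omega> n powr r / n) + (\<Sum>n\<in>{K<..N}. \<omega> n powr r / n)"
      by (simp add: sum.union_disjoint ivl_disj_int)
    moreover have "(\<Sum>n=1..K. \<omega> n powr r / n) \<le> C / \<rho> * \<omega> N powr r"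
    proof (cases "K = 0")
      case True
      then show ?thesis using C \<rho> by simp
    next
      case False
      have "\<phi> * \<omega> K \<le> \<omega> N"
        using M(3)[of K] weight_mono[OF w, of "M * K" N] K False M(1) by force
      then have "(\<phi> * \<omega> K) powr r \<le> \<omega> N powr r"
        using M(2) weight_pos[OF w, of K] False r by (intro powr_mono2) auto
      then have "\<omega> K powr r \<le> \<omega> N powr r / \<rho>"
        using M(2) weight_pos[OF w, of K] False \<rho> by (simp add: powr_mult \<rho>_def field_simps)
      then have "C * \<omega> K powr r \<le> C * (\<omega> N powr r / \<rho>)" using C by (intro mult_left_mono) auto
      then show ?thesis using less.IH[OF K(1)] False by simp
    qed
    \<comment> \<open>The block has at most \<open>M * (K + 1)\<close> indices, each with
      \<open>1 / n \<le> 1 / (K + 1)\<close>.\<close>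
    moreover have "(\<Sum>n\<in>{K<..N}. \<omega> n powr r / n) \<le> M * \<omega> N powr r"
    proof -
      have "(\<Sum>n\<in>{K<..N}. \<omega> n powr r / n) \<le> (\<Sum>n\<in>{K<..N}. \<omega> N powr r / real (K + 1))"
        using r weight_pos[OF w] weight_mono[OF w]
        by (intro sum_mono frac_le powr_mono2) (auto simp: less_imp_le)
      also have "\<dots> = real (N - K) / real (K + 1) * \<omega> N powr r" by simp
      also have "\<dots> \<le> M * \<omega> N powr r"
      proof (rule mult_right_mono)
        have "real (N - K) \<le> real (M * (K + 1))" using K by linarith
        then show "real (N - K) / real (K + 1) \<le> M"
          by (simp add: pos_divide_le_eq distrib_left)
      qed simp
      finally show ?thesis .
    qed
    ultimately have "(\<Sum>n=1..N. \<omega> n powr r / n) \<le> C / \<rho> * \<omega> N powr r + M * \<omega> N powr r"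
      by linarith
    also have "\<dots> = C * \<omega> N powr r" by (simp only: distrib_right[symmetric] CM)
    finally show ?case .
  qed
  then show ?thesis using C by blast
qed

text \<open>The hypothesis on \<beta> is the shape of the partial errors of the test vector: one
  level up to \<open>N\<close>, another up to \<open>L\<close>. The Hardy inequality lets a constant
  sequence of length \<open>N\<close> cost only its last weight, as it plainly does for the supremum
  norm.\<close>

lemma weighted_lq_upper:
  assumes w: "weight \<omega>" and i: "lower_dilation_index \<omega> > 0" and q: "q > 0"
  shows "\<exists>K>0. \<forall>N\<ge>1. \<forall>L\<ge>1. \<forall>a\<ge>0. \<forall>b\<ge>0. \<forall>\<beta>.
    (\<forall>n\<ge>1. \<beta> n \<le> ennreal ((if n \<le> N then a else 0) + (if n \<le> L then b else 0))) \<longrightarrow>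
    weighted_lq q \<omega> \<beta> \<le> ennreal (K * (\<omega> N * a + \<omega> L * b))"
proof (cases "q = top")
  case True
  have "weighted_lq q \<omega> \<beta> \<le> ennreal (1 * (\<omega> N * a + \<omega> L * b))"
    if "N \<ge> 1" "L \<ge> 1" "a \<ge> 0" "b \<ge> 0"
      and \<beta>: "\<forall>n\<ge>1. \<beta> n \<le> ennreal ((if n \<le> N then a else 0) + (if n \<le> L then b else 0))"
    for N L :: nat and a b :: real and \<beta>
  proof -
    have "ennreal (\<omega> n) * \<beta> n \<le> ennreal (1 * (\<omega> N * a + \<omega> L * b))" if n: "n \<ge> 1" for n
    proof -
      have "ennreal (\<omega> n) * \<beta> n
          \<le> ennreal (\<omega> n) * ennreal ((if n \<le> N then a else 0) + (if n \<le> L then b else 0))"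
        using \<beta> n by (intro mult_left_mono) auto
      also have "\<dots> = ennreal (\<omega> n * ((if n \<le> N then a else 0) + (if n \<le> L then b else 0)))"
        using weight_pos[OF w n] by (simp add: ennreal_mult')
      also have "\<dots> \<le> ennreal (1 * (\<omega> N * a + \<omega> L * b))"
        using \<open>a \<ge> 0\<close> \<open>b \<ge> 0\<close> weight_mono[OF w n] weight_pos[OF w, of N] weight_pos[OF w, of L]
          \<open>N \<ge> 1\<close> \<open>L \<ge> 1\<close>
        unfolding distrib_left mult_1
        by (intro ennreal_leI add_mono) (auto intro!: mult_right_mono)
      finally show ?thesis .
    qed
    then show ?thesis using True by (auto simp: weighted_lq_def intro: SUP_least)
  qed
  then show ?thesis by (intro exI[of _ 1]) auto
next
  case False
  define r where "r = enn2real q"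
  have r: "r > 0" using q False by (simp add: r_def enn2real_positive_iff less_top)
  obtain C where C: "C > 0" "\<And>N. N \<ge> 1 \<Longrightarrow> (\<Sum>n=1..N. \<omega> n powr r / n) \<le> C * \<omega> N powr r"
    using weight_hardy[OF w i r] by blast
  define K where "K = (2 powr r * (C * 2)) powr (1 / r)"
  have "weighted_lq q \<omega> \<beta> \<le> ennreal (K * (\<omega> N * a + \<omega> L * b))"
    if N: "N \<ge> 1" and L: "L \<ge> 1" and a: "a \<ge> 0" and b: "b \<ge> 0"
      and \<beta>: "\<forall>n\<ge>1. \<beta> n \<le> ennreal ((if n \<le> N then a else 0) + (if n \<le> L then b else 0))"
    for N L :: nat and a b :: real and \<beta>
  proof -
    define f where "f P c n = (if n \<le> P then (\<omega> n * c) powr r / n else 0)" for P :: nat and c :: real and n :: nat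
    have f0: "f P c n \<ge> 0" for P c n by (simp add: f_def)
    have term_le: "ennreal_powr (ennreal (\<omega> n) * \<beta> n) r / of_nat n \<le> ennreal (2 powr r * (f N a n + f L b n))"
      if n: "n \<ge> 1" for n
    proof -
      define s t where "s = (if n \<le> N then \<omega> n * a else 0)" and "t = (if n \<le> L then \<omega> n * b else 0)"
      have st: "s \<ge> 0" "t \<ge> 0" using a b weight_pos[OF w n] by (auto simp: s_def t_def)
      have "ennreal (\<omega> n) * \<beta> n
          \<le> ennreal (\<omega> n) * ennreal ((if n \<le> N then a else 0) + (if n \<le> L then b else 0))"
        using \<beta> n by (intro mult_left_mono) auto
      also have "\<dots> = ennreal (\<omega> n * ((if n \<le> N then a else 0) + (if n \<le> L then b else 0)))"
        using weight_pos[OF w n] by (simp add: ennreal_mult')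
      also have "\<dots> = ennreal (s + t)" by (simp add: s_def t_def distrib_left)
      finally have "ennreal_powr (ennreal (\<omega> n) * \<beta> n) r \<le> ennreal ((s + t) powr r)"
        using ennreal_powr_mono[of _ "ennreal (s + t)" r] r st
        by (simp add: ennreal_powr_ennreal del: ennreal_plus)
      \<comment> \<open>Going through the maximum covers the exponents below and above 1 at
        once.\<close>
      also have "(s + t) powr r \<le> 2 powr r * (s powr r + t powr r)"
      proof -
        have "(s + t) powr r \<le> (2 * max s t) powr r" using st r by (intro powr_mono2) auto
        also have "\<dots> = 2 powr r * max s t powr r" using st by (simp add: powr_mult)
        also have "\<dots> \<le> 2 powr r * (s powr r + t powr r)" by (simp add: max_def)
        finally show ?thesis .
      qed
      finally have "ennreal_powr (ennreal (\<omega> n) * \<beta> n) r / of_nat n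
          \<le> ennreal (2 powr r * (s powr r + t powr r)) / of_nat n"
        by (intro divide_right_mono_ennreal) (simp add: ennreal_leI)
      also have "\<dots> = ennreal (2 powr r * (s powr r + t powr r) / n)"
        using n by (simp add: divide_ennreal ennreal_of_nat_eq_real_of_nat)
      also have "2 powr r * (s powr r + t powr r) / n = 2 powr r * (f N a n + f L b n)"
        by (simp add: f_def s_def t_def add_divide_distrib distrib_left)
      finally show ?thesis .
    qed
    have fsum: "(\<Sum>n<max N L. f P c (Suc n)) \<le> C * (\<omega> P * c) powr r"
      if P: "P \<ge> 1" "P \<le> max N L" and c: "c \<ge> 0" for P c
    proof -
      have "(\<Sum>n<max N L. f P c (Suc n)) = (\<Sum>n\<in>Suc ` {..<max N L}. f P c n)"
        by (subst sum.reindex) auto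
      also have "\<dots> = (\<Sum>n=1..max N L. f P c n)"
        by (intro sum.cong) (auto simp: image_Suc_lessThan)
      also have "\<dots> = (\<Sum>n=1..P. f P c n)"
        using P by (intro sum.mono_neutral_right) (auto simp: f_def)
      also have "\<dots> = (\<Sum>n=1..P. c powr r * (\<omega> n powr r / n))"
        using weight_pos[OF w] c by (intro sum.cong) (auto simp: f_def powr_mult less_imp_le)
      also have "\<dots> = c powr r * (\<Sum>n=1..P. \<omega> n powr r / n)"
        by (simp add: sum_distrib_left)
      also have "\<dots> \<le> c powr r * (C * \<omega> P powr r)"
        using C(2)[OF P(1)] by (intro mult_left_mono) auto
      finally show ?thesis using weight_pos[OF w P(1)] c by (simp add: powr_mult ac_simps)
    qed
    define z where "z = \<omega> N * a + \<omega> L * b"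
    have nn: "\<omega> N * a \<ge> 0" "\<omega> L * b \<ge> 0" using a b weight_pos[OF w N] weight_pos[OF w L] by auto
    have "(\<Sum>n. ennreal_powr (ennreal (\<omega> (Suc n)) * \<beta> (Suc n)) r / of_nat (Suc n))
        \<le> (\<Sum>n. ennreal (2 powr r * (f N a (Suc n) + f L b (Suc n))))"
      by (intro suminf_le term_le) auto
    also have "\<dots> = (\<Sum>n<max N L. ennreal (2 powr r * (f N a (Suc n) + f L b (Suc n))))"
      by (intro suminf_finite) (auto simp: f_def)
    also have "\<dots> = ennreal (\<Sum>n<max N L. 2 powr r * (f N a (Suc n) + f L b (Suc n)))"
      using f0 by (intro sum_ennreal) (simp add: add_nonneg_nonneg)
    also have "(\<Sum>n<max N L. 2 powr r * (f N a (Suc n) + f L b (Suc n)))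
        = 2 powr r * ((\<Sum>n<max N L. f N a (Suc n)) + (\<Sum>n<max N L. f L b (Suc n)))"
      by (simp add: sum_distrib_left sum.distrib distrib_left)
    also have "\<dots> \<le> 2 powr r * (C * (\<omega> N * a) powr r + C * (\<omega> L * b) powr r)"
      using N L a b by (intro mult_left_mono add_mono fsum) auto
    also have "\<dots> \<le> 2 powr r * (C * z powr r + C * z powr r)"
      using C nn r by (intro mult_left_mono add_mono powr_mono2) (auto simp: z_def)
    also have "\<dots> = 2 powr r * (C * 2) * z powr r" by simp
    finally have "weighted_lq q \<omega> \<beta> \<le> ennreal_powr (ennreal (2 powr r * (C * 2) * z powr r)) (1 / r)"
      using False r by (auto simp: weighted_lq_def r_def[symmetric] ennreal_leI intro!: ennreal_powr_mono)
    also have "\<dots> = ennreal (K * z)"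
      using C r nn by (simp add: ennreal_powr_ennreal powr_mult powr_powr K_def z_def)
    finally show ?thesis by (simp add: z_def)
  qed
  moreover have "K > 0" using C by (simp add: K_def)
  ultimately show ?thesis by blast
qed

text \<open>A single dyadic block suffices: its \<open>p\<close> indices have
  \<open>1 / n \<ge> 1 / (2 * p)\<close> and weight at least \<open>\<omega> p\<close>, so they
  contribute half of \<open>(\<omega> p * g) powr r\<close>. This is where the factor
  \<open>1 / 2\<close> in \<open>c\<close> comes from.\<close>

lemma weighted_lq_lower:
  assumes w: "weight \<omega>" and q: "q > 0"
  shows "\<exists>c>0. \<forall>p\<ge>1. \<forall>g\<ge>0. \<forall>\<gamma>. (\<forall>n\<in>{p..<2*p}. ennreal g \<le> \<gamma> n) \<longrightarrow>
    ennreal (c * (\<omega> p * g)) \<le> weighted_lq q \<omega> \<gamma>"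
proof (cases "q = top")
  case True
  have "ennreal (1 * (\<omega> p * g)) \<le> weighted_lq q \<omega> \<gamma>"
    if p: "p \<ge> 1" and "g \<ge> 0" and \<gamma>: "\<forall>n\<in>{p..<2*p}. ennreal g \<le> \<gamma> n"
    for p :: nat and g :: real and \<gamma>
  proof -
    have "ennreal (1 * (\<omega> p * g)) = ennreal (\<omega> p) * ennreal g"
      using weight_pos[OF w p] by (simp add: ennreal_mult')
    also have "\<dots> \<le> ennreal (\<omega> p) * \<gamma> p" using \<gamma> p by (intro mult_left_mono) auto
    also have "\<dots> \<le> weighted_lq q \<omega> \<gamma>" using True p by (auto simp: weighted_lq_def intro: SUP_upper)
    finally show ?thesis .
  qed
  then show ?thesis by (intro exI[of _ 1]) auto
next
  case False
  define r where "r = enn2real q"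
  have r: "r > 0" using q False by (simp add: r_def enn2real_positive_iff less_top)
  define c :: real where "c = (1 / 2) powr (1 / r)"
  have "ennreal (c * (\<omega> p * g)) \<le> weighted_lq q \<omega> \<gamma>"
    if p: "p \<ge> 1" and g: "g \<ge> 0" and \<gamma>: "\<forall>n\<in>{p..<2*p}. ennreal g \<le> \<gamma> n"
    for p :: nat and g :: real and \<gamma>
  proof -
    define z where "z = \<omega> p * g"
    have z: "z \<ge> 0" using weight_pos[OF w p] g by (simp add: z_def)
    have "1 / 2 * z powr r = (\<Sum>n\<in>{p..<2*p}. z powr r / (2 * p))"
      using p by simp
    then have "ennreal (1 / 2 * z powr r) = ennreal (\<Sum>n\<in>{p..<2*p}. z powr r / (2 * p))"
      by (rule arg_cong)
    also have "\<dots> = (\<Sum>n\<in>{p..<2*p}. ennreal (z powr r / (2 * p)))"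
      by (rule sum_ennreal[symmetric]) simp
    also have "\<dots> \<le> (\<Sum>n\<in>{p..<2*p}. ennreal_powr (ennreal (\<omega> n) * \<gamma> n) r / of_nat n)"
    proof (rule sum_mono)
      fix n assume n: "n \<in> {p..<2*p}"
      have "ennreal z \<le> ennreal (\<omega> n * g)"
        using weight_mono[OF w p, of n] n g by (auto simp: z_def intro!: ennreal_leI mult_right_mono)
      also have "\<dots> = ennreal (\<omega> n) * ennreal g"
        using weight_pos[OF w, of n] n p by (simp add: ennreal_mult')
      also have "\<dots> \<le> ennreal (\<omega> n) * \<gamma> n" using \<gamma> n by (intro mult_left_mono) auto
      finally have "ennreal (z powr r) \<le> ennreal_powr (ennreal (\<omega> n) * \<gamma> n) r"
        using ennreal_powr_mono[of "ennreal z" _ r] r z by (simp add: ennreal_powr_ennreal)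
      then have "ennreal (z powr r) / of_nat n \<le> ennreal_powr (ennreal (\<omega> n) * \<gamma> n) r / of_nat n"
        by (rule divide_right_mono_ennreal)
      moreover have "ennreal (z powr r / (2 * p)) \<le> ennreal (z powr r) / of_nat n"
        using n p by (auto simp: divide_ennreal ennreal_of_nat_eq_real_of_nat intro!: ennreal_leI divide_left_mono)
      ultimately show "ennreal (z powr r / (2 * p)) \<le> ennreal_powr (ennreal (\<omega> n) * \<gamma> n) r / of_nat n"
        by (rule order_trans[rotated])
    qed
    also have "\<dots> = (\<Sum>n\<in>{p-1..<2*p-1}. ennreal_powr (ennreal (\<omega> (Suc n)) * \<gamma> (Suc n)) r / of_nat (Suc n))"
      using p by (subst sum.shift_bounds_Suc_ivl[symmetric]) (simp add: Suc_diff_le)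
    also have "\<dots> \<le> (\<Sum>n. ennreal_powr (ennreal (\<omega> (Suc n)) * \<gamma> (Suc n)) r / of_nat (Suc n))"
      by (intro sum_le_suminf) auto
    finally have "ennreal_powr (ennreal (1 / 2 * z powr r)) (1 / r) \<le> weighted_lq q \<omega> \<gamma>"
      using False r by (auto simp: weighted_lq_def r_def[symmetric] intro!: ennreal_powr_mono)
    moreover have "ennreal_powr (ennreal (1 / 2 * z powr r)) (1 / r) = ennreal (c * z)"
      using r z by (subst ennreal_powr_ennreal) (auto simp: powr_mult powr_powr c_def powr_divide)
    ultimately show ?thesis by (simp add: z_def)
  qed
  moreover have "c > 0" by (simp add: c_def)
  ultimately show ?thesis by blast
qed

subsection \<open>Finite sums in quasi-Banach spaces\<close>

context quasi_Banach_space
begin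

text \<open>The locale only asserts that such a constant exists; choosing one makes all later
  constants explicit expressions.\<close>

definition kappa :: real where
  "kappa = (SOME \<kappa>. \<kappa> \<ge> 1 \<and> (\<forall>x y. qnorm (x + y) \<le> \<kappa> * (qnorm x + qnorm y)))"

lemma kappa_props: "kappa \<ge> 1 \<and> (\<forall>x y. qnorm (x + y) \<le> kappa * (qnorm x + qnorm y))"
  unfolding kappa_def by (rule someI_ex) (use qnorm_triangle in blast)

lemma kappa_ge_1: "kappa \<ge> 1" and qnorm_add: "qnorm (x + y) \<le> kappa * (qnorm x + qnorm y)"
  using kappa_props by auto

lemma qnorm_minus: "qnorm (- x) = qnorm x"
  using qnorm_scale[of "-1" x] by simp

lemma qnorm_diff: "qnorm (x - y) \<le> kappa * (qnorm x + qnorm y)"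
  using qnorm_add[of x "- y"] by (simp add: qnorm_minus)

lemma qnorm_0 [simp]: "qnorm 0 = 0"
  by (simp add: qnorm_eq_0_iff)

text \<open>The factor depends on the number of summands. It is therefore applied only to a fixed
  number of levels, or where mere finiteness of a bound is the aim.\<close>

lemma qnorm_sum: "finite I \<Longrightarrow> qnorm (sum f I) \<le> kappa ^ card I * (\<Sum>i\<in>I. qnorm (f i))"
proof (induction I rule: finite_induct)
  case (insert i I)
  have "qnorm (sum f (insert i I)) \<le> kappa * (qnorm (f i) + qnorm (sum f I))"
    using insert by (simp add: qnorm_add)
  also have "\<dots> \<le> kappa * (kappa ^ card I * qnorm (f i) + kappa ^ card I * (\<Sum>i\<in>I. qnorm (f i)))"
    using insert kappa_ge_1 one_le_power[OF kappa_ge_1, of "card I"]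
      mult_right_mono[of 1 "kappa ^ card I" "qnorm (f i)"] qnorm_nonneg
    by (intro mult_left_mono add_mono) auto
  finally show ?case using insert by (simp add: distrib_left mult.assoc)
qed simp

end


context M_basis
begin

lemma signed_sum_empty [simp]: "signed_sum a {} = 0"
  by (simp add: signed_sum_def)

lemma signed_sum_Un:
  "finite A \<Longrightarrow> finite B \<Longrightarrow> A \<inter> B = {} \<Longrightarrow> signed_sum a (A \<union> B) = signed_sum a A + signed_sum a B"
  by (simp add: signed_sum_def sum.union_disjoint)

lemma signed_sum_Diff:
  "finite F \<Longrightarrow> A \<subseteq> F \<Longrightarrow> signed_sum a (F - A) = signed_sum a F - signed_sum a A"
  by (simp add: signed_sum_def sum_diff)

lemma signed_sum_cong: "A = B \<Longrightarrow> (\<And>n. n \<in> B \<Longrightarrow> a n = b n) \<Longrightarrow> signed_sum a A = signed_sum b B"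
  by (simp add: signed_sum_def)

lemma signed_sum_scale: "signed_sum (\<lambda>n. c * a n) A = c \<cdot> signed_sum a A"
  by (simp add: signed_sum_def scale_sum_right)

lemma unimodular_on_subset: "unimodular_on B a \<Longrightarrow> A \<subseteq> B \<Longrightarrow> unimodular_on A a"
  by (auto simp: unimodular_on_def)

lemma es_linear: "n \<ge> 1 \<Longrightarrow> Vector_Spaces.linear scale (*) (es n)"
  using functionals by (auto simp: dual_space_def)

lemma es_add: "n \<ge> 1 \<Longrightarrow> es n (x + y) = es n x + es n y"
  using es_linear[of n] by (simp add: Vector_Spaces.linear_iff)

lemma es_scale: "n \<ge> 1 \<Longrightarrow> es n (c \<cdot> x) = c * es n x"
  using es_linear[of n] by (simp add: Vector_Spaces.linear_iff)

lemma es_diff: "n \<ge> 1 \<Longrightarrow> es n (x - y) = es n x - es n y"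
  by (metis add_diff_cancel_right' diff_add_cancel es_add)

text \<open>\<open>signed_sum a F\<close> is used for arbitrary coefficients \<open>a\<close>, so it
  stands for a general finitely supported vector.\<close>

lemma es_signed_sum:
  assumes "finite F" "F \<subseteq> {1..}" "n \<ge> 1"
  shows "es n (signed_sum a F) = (if n \<in> F then a n else 0)"
  using assms
proof (induction F rule: finite_induct)
  case empty
  then show ?case using es_scale[of n 0 0] by simp
next
  case (insert k F)
  then have "signed_sum a (insert k F) = a k \<cdot> e k + signed_sum a F"
    by (simp add: signed_sum_def)
  then show ?case using insert biorthogonal[of n k] by (auto simp: es_add es_scale)
qed

end

subsection \<open>Greedy sets\<close>

lemma decreasing_list_of_finite_set:
  fixes f :: "'b \<Rightarrow> real"
  assumes "finite A"
  obtains xs where "set xs = A" "distinct xs" "sorted_wrt (\<lambda>x y. f x \<ge> f y) xs"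
proof -
  obtain ys where ys: "set ys = A" "distinct ys"
    using finite_distinct_list[OF assms] by blast
  have "sorted (map (\<lambda>x. - f x) (sort_key (\<lambda>x. - f x) ys))" by (rule sorted_sort_key)
  then show thesis
    using ys by (intro that[of "sort_key (\<lambda>x. - f x) ys"]) (auto simp: sorted_wrt_map)
qed

context M_basis
begin

text \<open>Bridges finite greedy sets and the infinite orderings behind
  \<open>greedy_error\<close>: list \<open>A\<close> decreasingly, then \<open>F - A\<close>
  decreasingly, then enumerate the complement of \<open>F\<close>, where all coefficients vanish.
  Ties between \<open>A\<close> and \<open>F - A\<close> are allowed, which leaves the choice of
  \<open>A\<close> free for unimodular coefficients.\<close>

lemma greedy_ordering_of_greedy_set:
  assumes F: "finite F" "F \<subseteq> {1..}" and A: "A \<subseteq> F"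
    and gr: "\<And>i j. i \<in> A \<Longrightarrow> j \<in> F - A \<Longrightarrow> norm (a j) \<le> norm (a i)"
  obtains \<pi> where "greedy_ordering (signed_sum a F) \<pi>" "\<pi> ` {1..card A} = A"
proof -
  have fA: "finite A" using F A finite_subset by blast
  define f where "f n = norm (a n)" for n
  obtain xs where xs: "set xs = A" "distinct xs" "sorted_wrt (\<lambda>x y. f x \<ge> f y) xs"
    using decreasing_list_of_finite_set[OF fA] by blast
  obtain ys where ys: "set ys = F - A" "distinct ys" "sorted_wrt (\<lambda>x y. f x \<ge> f y) ys"
    using decreasing_list_of_finite_set[of "F - A"] F by blast
  define zs where "zs = xs @ ys"
  have zs: "set zs = F" "distinct zs" "sorted_wrt (\<lambda>x y. f x \<ge> f y) zs"
    using xs ys A gr by (auto simp: zs_def sorted_wrt_append f_def)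
  have len: "length zs = card F" "length xs = card A"
    using zs xs distinct_card by metis+
  define I where "I = {1..} - F"
  have I: "infinite I" using F(1) infinite_Ici[of "1::nat"] by (simp add: I_def)
  \<comment> \<open>Positions of \<pi> start at 1, those of lists and of \<open>enumerate\<close> at
    0; this accounts for the subtractions of 1.\<close>
  define \<pi> where "\<pi> i = (if i \<le> card F then zs ! (i - 1) else enumerate I (i - card F - 1))" for i
  have in1: "\<pi> i \<in> F" if "1 \<le> i" "i \<le> card F" for i
    using that zs(1) len nth_mem[of "i - 1" zs] by (auto simp: \<pi>_def)
  have in2: "\<pi> i \<in> I" if "i > card F" for i
    using that enumerate_in_set[OF I] by (simp add: \<pi>_def)
  have "\<pi> ` {1..} \<subseteq> {1..}"
  proof safe
    fix i :: nat assume "i \<ge> 1"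
    then show "\<pi> i \<ge> 1" using in1[of i] in2[of i] F(2) by (cases "i \<le> card F") (auto simp: I_def)
  qed
  moreover have "inj_on \<pi> {1..}"
  proof (rule inj_onI)
    fix i j assume ij: "i \<in> {1..}" "j \<in> {1..}" "\<pi> i = \<pi> j"
    have FI: "F \<inter> I = {}" by (auto simp: I_def)
    consider "i \<le> card F" "j \<le> card F" | "i > card F" "j > card F"
      using ij in1[of i] in1[of j] in2[of i] in2[of j] FI
      by (metis atLeast_iff disjoint_iff not_le)
    then show "i = j"
    proof cases
      case 1
      then have "zs ! (i - 1) = zs ! (j - 1)" using ij by (simp add: \<pi>_def)
      then have "i - 1 = j - 1" using 1 ij zs len by (subst (asm) nth_eq_iff_index_eq) auto
      then show ?thesis using ij by simp
    next
      case 2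
      then have "enumerate I (i - card F - 1) = enumerate I (j - card F - 1)" using ij by (simp add: \<pi>_def)
      then have "i - card F - 1 = j - card F - 1"
        using inj_enumerate[OF I] by (simp add: inj_eq)
      then show ?thesis using 2 by simp
    qed
  qed
  moreover have sub: "F \<subseteq> \<pi> ` {1..}"
  proof
    fix n assume "n \<in> F"
    then obtain i where "i < card F" "n = zs ! i" using zs len by (metis in_set_conv_nth)
    then have "n = \<pi> (Suc i)" by (simp add: \<pi>_def)
    then show "n \<in> \<pi> ` {1..}" by auto
  qed
  moreover have "supp (signed_sum a F) \<subseteq> F"
    using F by (auto simp: supp_def es_signed_sum split: if_splits)
  moreover have "norm (es (\<pi> j) (signed_sum a F)) \<le> norm (es (\<pi> i) (signed_sum a F))"
    if ij: "1 \<le> i" "i \<le> j" for i j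
  proof (cases "j \<le> card F")
    case True
    have "f (zs ! (j - 1)) \<le> f (zs ! (i - 1))"
    proof (cases "i = j")
      case False
      then show ?thesis using zs(3) ij True len by (auto simp: sorted_wrt_iff_nth_less)
    qed simp
    then show ?thesis
      using ij True F in1[of i] in1[of j] by (auto simp: es_signed_sum \<pi>_def f_def subset_iff)
  next
    case False
    then have "es (\<pi> j) (signed_sum a F) = 0"
      using in2[of j] F by (auto simp: es_signed_sum I_def)
    then show ?thesis by simp
  qed
  ultimately have "greedy_ordering (signed_sum a F) \<pi>"
    unfolding greedy_ordering_def by auto
  moreover have "\<pi> ` {1..card A} = A"
  proof -
    have le: "card A \<le> card F" using A F by (simp add: card_mono)
    have "\<pi> ` {1..card A} = (\<lambda>i. xs ! (i - 1)) ` {1..card A}"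
      using le len by (intro image_cong) (auto simp: \<pi>_def zs_def nth_append)
    also have "\<dots> = (!) xs ` {..<length xs}"
    proof -
      have "{1..card A} = Suc ` {..<length xs}" by (simp add: len image_Suc_lessThan)
      then show ?thesis by (simp only: image_image) simp
    qed
    also have "\<dots> = A" using xs(1) by (auto simp: set_conv_nth)
    finally show ?thesis .
  qed
  ultimately show thesis by (rule that)
qed

text \<open>As the error is a supremum over orderings, one suitable ordering suffices. The bound
  serves twice: against quasi-greediness, and as the lower estimate in the embedding test.\<close>

lemma greedy_error_ge_of_greedy_set:
  assumes F: "finite F" "F \<subseteq> {1..}" and A: "A \<subseteq> F"
    and gr: "\<And>i j. i \<in> A \<Longrightarrow> j \<in> F - A \<Longrightarrow> norm (a j) \<le> norm (a i)"
  shows "ennreal (qnorm (signed_sum a (F - A))) \<le> greedy_error (card A) (signed_sum a F)"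
proof -
  obtain \<pi> where \<pi>: "greedy_ordering (signed_sum a F) \<pi>" "\<pi> ` {1..card A} = A"
    by (rule greedy_ordering_of_greedy_set[OF F A gr])
  have "inj_on \<pi> {1..card A}"
    using \<pi>(1) by (auto simp: greedy_ordering_def intro: inj_on_subset)
  then have "(\<Sum>n=1..card A. es (\<pi> n) (signed_sum a F) \<cdot> e (\<pi> n)) = (\<Sum>n\<in>A. es n (signed_sum a F) \<cdot> e n)"
    using sum.reindex[of \<pi> "{1..card A}" "\<lambda>n. es n (signed_sum a F) \<cdot> e n"] \<pi>(2) by simp
  also have "\<dots> = signed_sum a A"
    unfolding signed_sum_def[of a A]
  proof (intro sum.cong refl)
    fix n assume "n \<in> A"
    then have "n \<in> F" "n \<ge> 1" using F A by auto
    then show "es n (signed_sum a F) \<cdot> e n = a n \<cdot> e n" using es_signed_sum[OF F] by simp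
  qed
  finally have "signed_sum a (F - A)
      = signed_sum a F - (\<Sum>n=1..card A. es (\<pi> n) (signed_sum a F) \<cdot> e (\<pi> n))"
    using signed_sum_Diff F A by simp
  then show ?thesis
    unfolding greedy_error_def using \<pi>(1) by (auto intro!: SUP_upper)
qed

end

subsection \<open>Quasi-greedy bases\<close>

text \<open>Normalising the constant to be at least 1 extends the estimate to the empty greedy set,
  which the range \<open>m \<ge> 1\<close> leaves out.\<close>

locale quasi_greedy_basis = M_basis scale qnorm e es
  for scale :: "'f::real_normed_field \<Rightarrow> 'a::ab_group_add \<Rightarrow> 'a" (infixr "\<cdot>" 75)
    and qnorm :: "'a \<Rightarrow> real" and e :: "nat \<Rightarrow> 'a" and es :: "nat \<Rightarrow> 'a \<Rightarrow> 'f" +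
  fixes Cg :: real
  assumes Cg_ge_1: "Cg \<ge> 1"
    and greedy_error_le: "m \<ge> 1 \<Longrightarrow> greedy_error m x \<le> ennreal (Cg * qnorm x)"
begin

lemma qnorm_greedy_remainder:
  assumes F: "finite F" "F \<subseteq> {1..}" and A: "A \<subseteq> F"
    and gr: "\<And>i j. i \<in> A \<Longrightarrow> j \<in> F - A \<Longrightarrow> norm (a j) \<le> norm (a i)"
  shows "qnorm (signed_sum a (F - A)) \<le> Cg * qnorm (signed_sum a F)"
proof (cases "A = {}")
  case True
  then show ?thesis
    using mult_right_mono[OF Cg_ge_1 qnorm_nonneg[of "signed_sum a F"]] by simp
next
  case False
  then have A1: "card A \<ge> 1" using finite_subset[OF A F(1)] by (simp add: Suc_le_eq card_gt_0_iff)
  have "ennreal (qnorm (signed_sum a (F - A))) \<le> ennreal (Cg * qnorm (signed_sum a F))"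
    by (rule order_trans[OF greedy_error_ge_of_greedy_set[OF F A gr] greedy_error_le[OF A1]])
  then show ?thesis using Cg_ge_1 qnorm_nonneg by (simp add: ennreal_le_iff)
qed

definition Cp :: real where "Cp = kappa * (1 + Cg)"

lemma Cp_ge_1: "Cp \<ge> 1"
  using kappa_ge_1 Cg_ge_1 mult_mono[of 1 kappa 1 "1 + Cg"] by (simp add: Cp_def)

lemma qnorm_greedy_sum:
  assumes F: "finite F" "F \<subseteq> {1..}" and A: "A \<subseteq> F"
    and gr: "\<And>i j. i \<in> A \<Longrightarrow> j \<in> F - A \<Longrightarrow> norm (a j) \<le> norm (a i)"
  shows "qnorm (signed_sum a A) \<le> Cp * qnorm (signed_sum a F)"
proof -
  have "signed_sum a A = signed_sum a F - signed_sum a (F - A)"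
    using signed_sum_Diff[OF F(1) A, of a] by simp
  then have "qnorm (signed_sum a A) \<le> kappa * (qnorm (signed_sum a F) + qnorm (signed_sum a (F - A)))"
    by (metis qnorm_diff)
  also have "\<dots> \<le> kappa * (qnorm (signed_sum a F) + Cg * qnorm (signed_sum a F))"
    using kappa_ge_1 qnorm_greedy_remainder[OF F A gr] by (intro mult_left_mono add_left_mono) auto
  finally show ?thesis by (simp add: Cp_def algebra_simps)
qed

text \<open>With coefficients of equal modulus the set to be discarded, \<open>F - A\<close>, is
  itself greedy, so what remains is a greedy remainder. This is unconditionality for unimodular
  coefficients.\<close>

lemma qnorm_signed_sum_subset:
  assumes F: "finite F" "F \<subseteq> {1..}" and A: "A \<subseteq> F" and u: "unimodular_on F a"
  shows "qnorm (signed_sum a A) \<le> Cg * qnorm (signed_sum a F)"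
proof -
  have "qnorm (signed_sum a (F - (F - A))) \<le> Cg * qnorm (signed_sum a F)"
    using u by (intro qnorm_greedy_remainder F) (auto simp: unimodular_on_def)
  moreover have "F - (F - A) = A" using A by auto
  ultimately show ?thesis by simp
qed

text \<open>
  The supremum \<open>S\<close> of the left-hand sides is finite, and splitting \<open>b\<close> into \<open>L\<close> equal levels plus
  a remainder of size \<open>1 / L\<close> gives \<open>S \<le> kappa * (const * M + S / L)\<close>, so \<open>L \<ge> 2 * kappa\<close> bounds it.
\<close>

lemma qnorm_bounded_coefficients:
  "\<exists>K\<ge>1. \<forall>D b \<epsilon> M. finite D \<longrightarrow> D \<subseteq> {1..} \<longrightarrow> (\<forall>n\<in>D. b n \<in> {0..1}) \<longrightarrow>
     (\<forall>D'\<subseteq>D. qnorm (signed_sum \<epsilon> D') \<le> M) \<longrightarrow>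
     qnorm (signed_sum (\<lambda>n. of_real (b n) * \<epsilon> n) D) \<le> K * M"
proof -
  define L where "L = nat \<lceil>2 * kappa\<rceil>"
  have L: "real L \<ge> 2 * kappa" by (simp add: L_def real_nat_ceiling_ge)
  have L0: "real L > 0" using L kappa_ge_1 by linarith
  define K where "K = 2 * kappa * kappa ^ L"
  have "qnorm (signed_sum (\<lambda>n. of_real (b n) * \<epsilon> n) D) \<le> K * M"
    if D: "finite D" and b: "\<forall>n\<in>D. b n \<in> {0..1}" and M: "\<forall>D'\<subseteq>D. qnorm (signed_sum \<epsilon> D') \<le> M"
    for D :: "nat set" and b :: "nat \<Rightarrow> real" and \<epsilon> M
  proof -
    define v where "v c = qnorm (signed_sum (\<lambda>n. of_real (c n) * \<epsilon> n) D)" for c :: "nat \<Rightarrow> real"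
    define B where "B = {c :: nat \<Rightarrow> real. \<forall>n\<in>D. c n \<in> {0..1}}"
    \<comment> \<open>This bound depends on \<open>D\<close> and does not enter \<open>K\<close>; it
      makes the supremum \<open>S\<close> finite, so that \<open>S / 2\<close> can be subtracted
      later.\<close>
    have "v c \<le> kappa ^ card D * (\<Sum>n\<in>D. qnorm (\<epsilon> n \<cdot> e n))" if "c \<in> B" for c
    proof -
      have "v c \<le> kappa ^ card D * (\<Sum>n\<in>D. qnorm ((of_real (c n) * \<epsilon> n) \<cdot> e n))"
        unfolding v_def signed_sum_def by (rule qnorm_sum[OF D])
      also have "\<dots> \<le> kappa ^ card D * (\<Sum>n\<in>D. qnorm (\<epsilon> n \<cdot> e n))"
        using that kappa_ge_1 qnorm_nonneg
        by (intro mult_left_mono sum_mono)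
          (auto simp: B_def qnorm_scale norm_mult mult.assoc intro!: mult_left_le_one_le)
      finally show ?thesis .
    qed
    then have bdd: "bdd_above (v ` B)" by (rule bdd_aboveI2)
    define S where "S = (SUP c\<in>B. v c)"
    have step: "v c \<le> kappa * (kappa ^ L * M) + S / 2" if c: "c \<in> B" for c
    proof -
      define r where "r n = frac (real L * c n)" for n
      \<comment> \<open>Exactly the first \<lfloor>\<open>L * c n\<close>\<rfloor> of the sets
        \<open>T 0\<close>, ..., \<open>T (L - 1)\<close> contain \<open>n\<close>; the fractional
        part \<open>r n\<close> is again an admissible coefficient, which closes the loop with
        \<open>S\<close>.\<close>
      define T where "T i = {n\<in>D. real (Suc i) \<le> real L * c n}" for i
      have "r \<in> B" by (auto simp: B_def r_def frac_ge_0 less_imp_le frac_lt_1)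
      then have vr: "v r \<le> S" unfolding S_def by (rule cSUP_upper[OF _ bdd])
      have lev: "c n = (\<Sum>i<L. if n \<in> T i then 1 / L else 0) + r n / L" if n: "n \<in> D" for n
      proof -
        define k where "k = nat \<lfloor>real L * c n\<rfloor>"
        have c01: "0 \<le> real L * c n" "real L * c n \<le> real L"
          using c n L0 by (auto simp: B_def mult_left_le)
        then have k: "real k = real_of_int \<lfloor>real L * c n\<rfloor>" "k \<le> L"
          by (auto simp: k_def) linarith
        have "n \<in> T i \<longleftrightarrow> i < k" for i
          using n c01 k(1) by (auto simp: T_def) linarith+
        then have "(\<Sum>i<L. if n \<in> T i then 1 / real L else 0) = (\<Sum>i<k. 1 / real L)"
          using k(2) by (intro sum.mono_neutral_cong_right) auto
        also have "\<dots> = k / L" by simp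
        finally show ?thesis using k(1) L0 by (simp add: r_def frac_def field_simps)
      qed
      have "signed_sum (\<lambda>n. of_real (c n) * \<epsilon> n) D
          = (\<Sum>n\<in>D. (\<Sum>i<L. if n \<in> T i then of_real (1 / L) \<cdot> \<epsilon> n \<cdot> e n else 0)
              + of_real (1 / L) \<cdot> (of_real (r n) * \<epsilon> n) \<cdot> e n)"
        unfolding signed_sum_def
      proof (intro sum.cong refl)
        fix n assume n: "n \<in> D"
        have "(of_real (c n) * \<epsilon> n) \<cdot> e n
            = ((\<Sum>i<L. of_real (if n \<in> T i then 1 / L else 0)) + of_real (r n / L) :: 'f) \<cdot> \<epsilon> n \<cdot> e n"
          by (subst lev[OF n]) (simp only: of_real_add of_real_sum scale_scale)
        also have "\<dots> = (\<Sum>i<L. of_real (if n \<in> T i then 1 / L else 0) \<cdot> \<epsilon> n \<cdot> e n)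
            + of_real (r n / L) \<cdot> \<epsilon> n \<cdot> e n"
          by (simp only: scale_left_distrib scale_sum_left)
        also have "of_real (r n / L) \<cdot> \<epsilon> n \<cdot> e n = of_real (1 / L) \<cdot> (of_real (r n) * \<epsilon> n) \<cdot> e n"
          by simp
        also have "(\<Sum>i<L. of_real (if n \<in> T i then 1 / L else 0) \<cdot> \<epsilon> n \<cdot> e n)
            = (\<Sum>i<L. if n \<in> T i then of_real (1 / L) \<cdot> \<epsilon> n \<cdot> e n else 0)"
          by (intro sum.cong refl) simp
        finally show "(of_real (c n) * \<epsilon> n) \<cdot> e n
            = (\<Sum>i<L. if n \<in> T i then of_real (1 / L) \<cdot> \<epsilon> n \<cdot> e n else 0)
              + of_real (1 / L) \<cdot> (of_real (r n) * \<epsilon> n) \<cdot> e n" .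
      qed
      also have "\<dots> = (\<Sum>i<L. of_real (1 / L) \<cdot> signed_sum \<epsilon> (T i))
          + of_real (1 / L) \<cdot> signed_sum (\<lambda>n. of_real (r n) * \<epsilon> n) D"
      proof -
        have "(\<Sum>n\<in>D. \<Sum>i<L. if n \<in> T i then of_real (1 / L) \<cdot> \<epsilon> n \<cdot> e n else 0)
            = (\<Sum>i<L. \<Sum>n\<in>D. if n \<in> T i then of_real (1 / L) \<cdot> \<epsilon> n \<cdot> e n else 0)"
          by (rule sum.swap)
        also have "\<dots> = (\<Sum>i<L. \<Sum>n\<in>T i. of_real (1 / L) \<cdot> \<epsilon> n \<cdot> e n)"
          using D by (intro sum.cong refl sum.mono_neutral_cong_right) (auto simp: T_def)
        finally show ?thesis by (simp add: sum.distrib signed_sum_def scale_sum_right)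
      qed
      finally have "v c \<le> kappa * (qnorm (\<Sum>i<L. of_real (1 / L) \<cdot> signed_sum \<epsilon> (T i))
          + qnorm (of_real (1 / L) \<cdot> signed_sum (\<lambda>n. of_real (r n) * \<epsilon> n) D))"
        unfolding v_def by (metis qnorm_add)
      also have "\<dots> \<le> kappa * (kappa ^ L * M + S / L)"
      proof (intro mult_left_mono add_mono)
        have "qnorm (\<Sum>i<L. of_real (1 / L) \<cdot> signed_sum \<epsilon> (T i))
            \<le> kappa ^ L * (\<Sum>i<L. qnorm (of_real (1 / L) \<cdot> signed_sum \<epsilon> (T i)))"
          using qnorm_sum[of "{..<L}"] by simp
        also have "\<dots> \<le> kappa ^ L * (\<Sum>i<L. 1 / L * M)"
        proof (intro mult_left_mono sum_mono)
          fix i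
          have "T i \<subseteq> D" by (auto simp: T_def)
          then show "qnorm (of_real (1 / L) \<cdot> signed_sum \<epsilon> (T i)) \<le> 1 / L * M"
            using M L0 by (simp add: qnorm_scale norm_divide divide_right_mono)
        qed (use kappa_ge_1 in auto)
        finally show "qnorm (\<Sum>i<L. of_real (1 / L) \<cdot> signed_sum \<epsilon> (T i)) \<le> kappa ^ L * M"
          using L0 by simp
        show "qnorm (of_real (1 / L) \<cdot> signed_sum (\<lambda>n. of_real (r n) * \<epsilon> n) D) \<le> S / L"
          using vr L0 by (simp add: qnorm_scale norm_divide v_def divide_right_mono)
      qed (use kappa_ge_1 in auto)
      also have "\<dots> \<le> kappa * (kappa ^ L * M) + S / 2"
      proof -
        have "0 \<le> v r" by (simp add: v_def qnorm_nonneg)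
        then have "S \<ge> 0" using vr by linarith
        then have "2 * kappa * S \<le> L * S" using L by (intro mult_right_mono)
        then show ?thesis using L0 by (simp add: distrib_left field_simps)
      qed
      finally show ?thesis .
    qed
    have bB: "b \<in> B" using b by (simp add: B_def)
    then have "S \<le> kappa * (kappa ^ L * M) + S / 2"
      unfolding S_def by (intro cSUP_least step[unfolded S_def]) auto
    moreover have "v b \<le> S" unfolding S_def by (rule cSUP_upper[OF bB bdd])
    ultimately show ?thesis by (simp add: v_def K_def mult.assoc)
  qed
  moreover have "K \<ge> 1"
  proof -
    have "1 * 1 \<le> (2 * kappa) * kappa ^ L"
      using kappa_ge_1 one_le_power[OF kappa_ge_1] by (intro mult_mono) auto
    then show ?thesis by (simp add: K_def)
  qed
  ultimately show ?thesis by blast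
qed

text \<open>For unimodular signs quasi-greediness bounds all subsums by \<open>Cg\<close> times the
  full sum, and this is the \<open>M\<close> required by the previous lemma.\<close>

lemma qnorm_unimodular_bounded:
  "\<exists>K\<ge>1. \<forall>D b \<epsilon>. finite D \<longrightarrow> D \<subseteq> {1..} \<longrightarrow> unimodular_on D \<epsilon> \<longrightarrow> (\<forall>n\<in>D. b n \<in> {0..1}) \<longrightarrow>
     qnorm (signed_sum (\<lambda>n. of_real (b n) * \<epsilon> n) D) \<le> K * qnorm (signed_sum \<epsilon> D)"
proof -
  obtain K where K: "K \<ge> 1" "\<And>D b \<epsilon> M. finite D \<Longrightarrow> D \<subseteq> {1..} \<Longrightarrow> \<forall>n\<in>D. b n \<in> {0..1} \<Longrightarrow>
     \<forall>D'\<subseteq>D. qnorm (signed_sum \<epsilon> D') \<le> M \<Longrightarrow>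
     qnorm (signed_sum (\<lambda>n. of_real (b n) * \<epsilon> n) D) \<le> K * M"
    using qnorm_bounded_coefficients by blast
  have "qnorm (signed_sum (\<lambda>n. of_real (b n) * \<epsilon> n) D) \<le> (K * Cg) * qnorm (signed_sum \<epsilon> D)"
    if "finite D" "D \<subseteq> {1..}" "unimodular_on D \<epsilon>" "\<forall>n\<in>D. b n \<in> {0..1}" for D b \<epsilon>
    using K(2)[OF that(1,2,4), of \<epsilon> "Cg * qnorm (signed_sum \<epsilon> D)"]
      qnorm_signed_sum_subset[OF that(1,2) _ that(3)] by (simp add: mult.assoc)
  moreover have "K * Cg \<ge> 1" using mult_mono[of 1 K 1 Cg] K(1) Cg_ge_1 by simp
  ultimately show ?thesis by blast
qed

section \<open>Replacing large coefficients by their signs\<close>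

lemma of_real_norm_mult_sgn: "of_real (norm x) * sgn x = (x :: 'f)"
  by (cases "x = 0") (simp_all add: sgn_div_norm scaleR_conv_of_real)

text \<open>
  On a narrow range \<open>a n = s * (1 + \<eta> * b n) * sgn (a n)\<close> with \<open>b n \<in> {0..1}\<close>, and for small \<open>\<eta>\<close> the
  perturbation is absorbed.
\<close>

lemma qnorm_sgn_narrow_range:
  "\<exists>\<rho>>1. \<exists>K\<ge>1. \<forall>D a s. finite D \<longrightarrow> D \<subseteq> {1..} \<longrightarrow> s > 0 \<longrightarrow> (\<forall>n\<in>D. norm (a n) \<in> {s..\<rho> * s}) \<longrightarrow>
     s * qnorm (signed_sum (\<lambda>n. sgn (a n)) D) \<le> K * qnorm (signed_sum a D)"
proof -
  obtain K where K: "K \<ge> 1" "\<And>D b \<epsilon>. finite D \<Longrightarrow> D \<subseteq> {1..} \<Longrightarrow> unimodular_on D \<epsilon> \<Longrightarrow>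
     \<forall>n\<in>D. b n \<in> {0..1} \<Longrightarrow>
     qnorm (signed_sum (\<lambda>n. of_real (b n) * \<epsilon> n) D) \<le> K * qnorm (signed_sum \<epsilon> D)"
    using qnorm_unimodular_bounded by blast
  \<comment> \<open>Chosen so that the perturbation costs \<open>kappa * s * \<eta> * K\<close>
    times the norm of the sign sum, which is exactly half of the quantity \<open>q\<close> being
    estimated.\<close>
  define \<eta> where "\<eta> = 1 / (2 * kappa * K)"
  have \<eta>: "\<eta> > 0" using K(1) kappa_ge_1 by (simp add: \<eta>_def)
  have "s * qnorm (signed_sum (\<lambda>n. sgn (a n)) D) \<le> (2 * kappa) * qnorm (signed_sum a D)"
    if D: "finite D" "D \<subseteq> {1..}" and s: "s > 0" and a: "\<forall>n\<in>D. norm (a n) \<in> {s..(1 + \<eta>) * s}"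
    for D :: "nat set" and a :: "nat \<Rightarrow> 'f" and s
  proof -
    define \<epsilon> where "\<epsilon> n = sgn (a n)" for n
    define b where "b n = (norm (a n) - s) / (s * \<eta>)" for n
    define q where "q = s * qnorm (signed_sum \<epsilon> D)"
    have u: "unimodular_on D \<epsilon>" using a s by (auto simp: unimodular_on_def \<epsilon>_def norm_sgn)
    have b: "\<forall>n\<in>D. b n \<in> {0..1}" using a s \<eta> by (auto simp: b_def field_simps)
    have "of_real s \<cdot> signed_sum \<epsilon> D
        = signed_sum a D - of_real (s * \<eta>) \<cdot> signed_sum (\<lambda>n. of_real (b n) * \<epsilon> n) D"
    proof -
      have "a n = of_real s * \<epsilon> n + of_real (s * \<eta>) * (of_real (b n) * \<epsilon> n)" for n
      proof -
        have "norm (a n) = s + s * \<eta> * b n" using s \<eta> by (simp add: b_def)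
        then have "a n = of_real (s + s * \<eta> * b n) * \<epsilon> n"
          using of_real_norm_mult_sgn[of "a n"] by (simp add: \<epsilon>_def)
        then show ?thesis by (simp add: algebra_simps)
      qed
      then have "signed_sum a D
          = signed_sum (\<lambda>n. of_real s * \<epsilon> n + of_real (s * \<eta>) * (of_real (b n) * \<epsilon> n)) D"
        by (intro signed_sum_cong) auto
      also have "\<dots> = of_real s \<cdot> signed_sum \<epsilon> D
          + of_real (s * \<eta>) \<cdot> signed_sum (\<lambda>n. of_real (b n) * \<epsilon> n) D"
        unfolding signed_sum_def
        by (simp only: scale_left_distrib sum.distrib scale_sum_right scale_scale)
      finally show ?thesis by simp
    qed
    then have "qnorm (of_real s \<cdot> signed_sum \<epsilon> D) \<le> kappa * (qnorm (signed_sum a D)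
        + qnorm (of_real (s * \<eta>) \<cdot> signed_sum (\<lambda>n. of_real (b n) * \<epsilon> n) D))"
      by (metis qnorm_diff)
    then have "q \<le> kappa * (qnorm (signed_sum a D)
        + s * \<eta> * qnorm (signed_sum (\<lambda>n. of_real (b n) * \<epsilon> n) D))"
      using s \<eta> by (simp add: qnorm_scale q_def norm_mult)
    also have "\<dots> \<le> kappa * (qnorm (signed_sum a D) + s * \<eta> * (K * qnorm (signed_sum \<epsilon> D)))"
      using K(2)[OF D u b] s \<eta> kappa_ge_1 by (intro mult_left_mono add_left_mono) auto
    also have "\<dots> = kappa * qnorm (signed_sum a D) + q / 2"
      using K(1) kappa_ge_1 by (simp add: \<eta>_def q_def field_simps)
    finally show ?thesis by (simp add: q_def \<epsilon>_def[abs_def])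
  qed
  moreover have "1 + \<eta> > 1" "2 * kappa \<ge> 1" using \<eta> kappa_ge_1 by auto
  ultimately show ?thesis by blast
qed

text \<open>The narrow ratio \<rho> is iterated until its power exceeds \<open>R\<close>. In each
  step the coefficients above \<open>\<rho> ^ Suc i * s\<close> form a greedy set with ratio at most
  \<rho>, and the others a greedy remainder handled by induction. The constant may depend on
  \<open>R\<close>, since \<open>R\<close> is fixed before the final induction.\<close>

lemma qnorm_sgn_bounded_range:
  "\<exists>K\<ge>1. \<forall>D a s. finite D \<longrightarrow> D \<subseteq> {1..} \<longrightarrow> s > 0 \<longrightarrow> (\<forall>n\<in>D. norm (a n) \<in> {s..R * s}) \<longrightarrow>
     s * qnorm (signed_sum (\<lambda>n. sgn (a n)) D) \<le> K * qnorm (signed_sum a D)"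
proof -
  obtain \<rho> K where \<rho>: "\<rho> > 1" and K: "K \<ge> 1" "\<And>D a s. finite D \<Longrightarrow> D \<subseteq> {1..} \<Longrightarrow> s > 0 \<Longrightarrow>
     \<forall>n\<in>D. norm (a n) \<in> {s..\<rho> * s} \<Longrightarrow>
     s * qnorm (signed_sum (\<lambda>n. sgn (a n)) D) \<le> K * qnorm (signed_sum a D)"
    using qnorm_sgn_narrow_range by blast
  have *: "\<exists>K\<ge>1. \<forall>D a s. finite D \<longrightarrow> D \<subseteq> {1..} \<longrightarrow> s > 0 \<longrightarrow> (\<forall>n\<in>D. norm (a n) \<in> {s..\<rho> ^ Suc i * s}) \<longrightarrow>
     s * qnorm (signed_sum (\<lambda>n. sgn (a n)) D) \<le> K * qnorm (signed_sum a D)" for i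
  proof (induction i)
    case 0
    have "\<rho> ^ Suc 0 = \<rho>" by simp
    then show ?case using K by metis
  next
    case (Suc i)
    then obtain K' where K': "K' \<ge> 1" "\<And>D a s. finite D \<Longrightarrow> D \<subseteq> {1..} \<Longrightarrow> s > 0 \<Longrightarrow>
       \<forall>n\<in>D. norm (a n) \<in> {s..\<rho> ^ Suc i * s} \<Longrightarrow>
       s * qnorm (signed_sum (\<lambda>n. sgn (a n)) D) \<le> K' * qnorm (signed_sum a D)"
      by blast
    have "s * qnorm (signed_sum (\<lambda>n. sgn (a n)) D) \<le> (kappa * (K * Cp + K' * Cg)) * qnorm (signed_sum a D)"
      if D: "finite D" "D \<subseteq> {1..}" and s: "s > 0" and a: "\<forall>n\<in>D. norm (a n) \<in> {s..\<rho> ^ Suc (Suc i) * s}"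
      for D :: "nat set" and a :: "nat \<Rightarrow> 'f" and s
    proof -
      define s' where "s' = \<rho> ^ Suc i * s"
      have s': "s' \<ge> s" using \<rho> s one_le_power[of \<rho> "Suc i"] by (simp add: s'_def del: power_Suc)
      define U where "U = {n\<in>D. norm (a n) > s'}"
      have U: "U \<subseteq> D" "finite U" "U \<subseteq> {1..}" using D by (auto simp: U_def)
      have V: "finite (D - U)" "D - U \<subseteq> {1..}" using D by auto
      let ?s = "\<lambda>n. sgn (a n)"
      have gr: "norm (a j) \<le> norm (a i)" if "i \<in> U" "j \<in> D - U" for i j
        using that by (auto simp: U_def)
      have "s * qnorm (signed_sum ?s D) \<le> s * (kappa * (qnorm (signed_sum ?s U) + qnorm (signed_sum ?s (D - U))))"
      proof -
        have "signed_sum ?s D = signed_sum ?s U + signed_sum ?s (D - U)"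
          by (simp add: signed_sum_Diff[OF D(1) U(1)])
        then show ?thesis using s by (auto intro!: mult_left_mono qnorm_add)
      qed
      also have "\<dots> = kappa * (s * qnorm (signed_sum ?s U) + s * qnorm (signed_sum ?s (D - U)))"
        by (simp add: algebra_simps)
      also have "\<dots> \<le> kappa * (s' * qnorm (signed_sum ?s U) + s * qnorm (signed_sum ?s (D - U)))"
        using s' kappa_ge_1 qnorm_nonneg by (intro mult_left_mono add_mono mult_right_mono) auto
      also have "\<dots> \<le> kappa * (K * qnorm (signed_sum a U) + K' * qnorm (signed_sum a (D - U)))"
      proof (intro mult_left_mono add_mono)
        show "s' * qnorm (signed_sum ?s U) \<le> K * qnorm (signed_sum a U)"
        proof (rule K(2)[OF U(2,3)])
          show "s' > 0" using s s' by simp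
          show "\<forall>n\<in>U. norm (a n) \<in> {s'..\<rho> * s'}"
            using a by (auto simp: U_def s'_def mult.assoc)
        qed
        show "s * qnorm (signed_sum ?s (D - U)) \<le> K' * qnorm (signed_sum a (D - U))"
          using a s by (intro K'(2) V) (auto simp: U_def s'_def)
      qed (use kappa_ge_1 in auto)
      also have "\<dots> \<le> kappa * (K * (Cp * qnorm (signed_sum a D)) + K' * (Cg * qnorm (signed_sum a D)))"
        using K(1) K'(1) kappa_ge_1
        by (intro mult_left_mono add_mono qnorm_greedy_sum[OF D U(1) gr] qnorm_greedy_remainder[OF D U(1) gr]) auto
      finally show ?thesis by (simp add: algebra_simps)
    qed
    moreover have "kappa * (K * Cp + K' * Cg) \<ge> 1"
    proof -
      have "1 * (1 * 1) \<le> kappa * (K * Cp)"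
        using kappa_ge_1 K(1) Cp_ge_1 by (intro mult_mono) auto
      moreover have "0 \<le> kappa * (K' * Cg)" using kappa_ge_1 K'(1) Cg_ge_1 by auto
      ultimately show ?thesis by (simp add: distrib_left)
    qed
    ultimately show ?case by blast
  qed
  obtain i where i: "R < \<rho> ^ i" using real_arch_pow[OF \<rho>] by blast
  also have "\<rho> ^ i \<le> \<rho> ^ Suc i" using \<rho> by simp
  finally have i: "R \<le> \<rho> ^ Suc i" by simp
  obtain K' where K': "K' \<ge> 1" "\<And>D a s. finite D \<Longrightarrow> D \<subseteq> {1..} \<Longrightarrow> s > 0 \<Longrightarrow>
       \<forall>n\<in>D. norm (a n) \<in> {s..\<rho> ^ Suc i * s} \<Longrightarrow>
       s * qnorm (signed_sum (\<lambda>n. sgn (a n)) D) \<le> K' * qnorm (signed_sum a D)"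
    using *[of i] by blast
  have "s * qnorm (signed_sum (\<lambda>n. sgn (a n)) D) \<le> K' * qnorm (signed_sum a D)"
    if "finite D" "D \<subseteq> {1..}" and s: "s > 0" and a: "\<forall>n\<in>D. norm (a n) \<in> {s..R * s}" for D a s
  proof (rule K'(2)[OF that(1,2,3)])
    have "R * s \<le> \<rho> ^ Suc i * s" using i s by (intro mult_right_mono) auto
    then show "\<forall>n\<in>D. norm (a n) \<in> {s..\<rho> ^ Suc i * s}" using a by fastforce
  qed
  then show ?thesis using K'(1) by blast
qed

text \<open>
  Strong induction on \<open>card D\<close>: the part of \<open>D\<close> where \<open>norm (a n)\<close> exceeds \<open>R\<close> times its minimum
  contributes \<open>1 / R\<close> times the induction hypothesis, which a large \<open>R\<close> absorbs.
\<close>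

lemma qnorm_sgn_le:
  "\<exists>K\<ge>1. \<forall>D a s. finite D \<longrightarrow> D \<subseteq> {1..} \<longrightarrow> s > 0 \<longrightarrow> (\<forall>n\<in>D. s \<le> norm (a n)) \<longrightarrow>
     s * qnorm (signed_sum (\<lambda>n. sgn (a n)) D) \<le> K * qnorm (signed_sum a D)"
proof -
  \<comment> \<open>\<open>R\<close> and \<open>K\<close> are balanced: the large coefficients cost
    \<open>kappa * Cp * K / R = K / 2\<close> and the bounded range costs
    \<open>kappa * K0 * Cg = K / 2\<close>, so the induction reproduces \<open>K\<close> without
    loss.\<close>
  define R where "R = 2 * kappa * Cp"
  have R: "R \<ge> 1"
    using mult_mono[of 1 kappa 1 Cp] kappa_ge_1 Cp_ge_1 by (simp add: R_def)
  obtain K0 where K0: "K0 \<ge> 1" "\<And>D a s. finite D \<Longrightarrow> D \<subseteq> {1..} \<Longrightarrow> s > 0 \<Longrightarrow>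
     \<forall>n\<in>D. norm (a n) \<in> {s..R * s} \<Longrightarrow>
     s * qnorm (signed_sum (\<lambda>n. sgn (a n)) D) \<le> K0 * qnorm (signed_sum a D)"
    using qnorm_sgn_bounded_range[of R] by blast
  define K where "K = 2 * kappa * (K0 * Cg)"
  have K: "K \<ge> 1"
    using mult_mono[of 1 kappa 1 "K0 * Cg"] mult_mono[of 1 K0 1 Cg] kappa_ge_1 K0(1) Cg_ge_1
    by (simp add: K_def)
  have "s * qnorm (signed_sum (\<lambda>n. sgn (a n)) D) \<le> K * qnorm (signed_sum a D)"
    if "finite D" "D \<subseteq> {1..}" "s > 0" "\<forall>n\<in>D. s \<le> norm (a n)" for D a s
    using that
  proof (induction "card D" arbitrary: D s rule: less_induct)
    case less
    note D = less.prems(1,2)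
    let ?s = "\<lambda>n. sgn (a n)"
    show ?case
    proof (cases "D = {}")
      case False
      \<comment> \<open>Measuring from the actual minimum rather than from \<open>s\<close> keeps a
        minimising index out of \<open>U\<close>, so \<open>card U\<close> drops strictly; the
        induction hypothesis is then used with threshold \<open>R * t\<close>.\<close>
      define t where "t = Min ((\<lambda>n. norm (a n)) ` D)"
      have "t \<in> (\<lambda>n. norm (a n)) ` D" unfolding t_def using D False by (intro Min_in) auto
      then obtain n0 where n0: "n0 \<in> D" "t = norm (a n0)" by auto
      have t: "t \<le> norm (a n)" if "n \<in> D" for n using D that by (simp add: t_def)
      have st: "s \<le> t" using less.prems n0 by auto
      then have t0: "t > 0" using less.prems by simp
      have Rt: "R * t \<ge> t" using R t0 by simp
      define U where "U = {n\<in>D. norm (a n) > R * t}"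
      have U: "U \<subseteq> D" "finite U" "U \<subseteq> {1..}" using D by (auto simp: U_def)
      have V: "finite (D - U)" "D - U \<subseteq> {1..}" using D by auto
      have "n0 \<notin> U" using n0 Rt by (simp add: U_def)
      then have "card U < card D" using U n0 D by (intro psubset_card_mono) auto
      then have IH: "R * t * qnorm (signed_sum ?s U) \<le> K * qnorm (signed_sum a U)"
        using U R t0 by (intro less.hyps) (auto simp: U_def)
      have gr: "norm (a j) \<le> norm (a i)" if "i \<in> U" "j \<in> D - U" for i j
        using that by (auto simp: U_def)
      have "s * qnorm (signed_sum ?s D) \<le> t * qnorm (signed_sum ?s D)"
        using st qnorm_nonneg by (intro mult_right_mono) auto
      also have "\<dots> \<le> t * (kappa * (qnorm (signed_sum ?s (D - U)) + qnorm (signed_sum ?s U)))"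
      proof -
        have "signed_sum ?s D = signed_sum ?s (D - U) + signed_sum ?s U"
          by (simp add: signed_sum_Diff[OF D(1) U(1)])
        then show ?thesis using t0 by (auto intro!: mult_left_mono qnorm_add)
      qed
      also have "\<dots> = kappa * (t * qnorm (signed_sum ?s (D - U)) + 1 / R * (R * t * qnorm (signed_sum ?s U)))"
        using R by (simp add: field_simps)
      also have "\<dots> \<le> kappa * (K0 * (Cg * qnorm (signed_sum a D)) + 1 / R * (K * (Cp * qnorm (signed_sum a D))))"
      proof (intro mult_left_mono add_mono)
        have "t * qnorm (signed_sum ?s (D - U)) \<le> K0 * qnorm (signed_sum a (D - U))"
          using t t0 by (intro K0(2) V) (auto simp: U_def)
        also have "\<dots> \<le> K0 * (Cg * qnorm (signed_sum a D))"
          using K0(1) by (intro mult_left_mono qnorm_greedy_remainder[OF D U(1) gr]) auto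
        finally show "t * qnorm (signed_sum ?s (D - U)) \<le> K0 * (Cg * qnorm (signed_sum a D))" .
        have "K * qnorm (signed_sum a U) \<le> K * (Cp * qnorm (signed_sum a D))"
          using K by (intro mult_left_mono qnorm_greedy_sum[OF D U(1) gr]) auto
        then show "R * t * qnorm (signed_sum ?s U) \<le> K * (Cp * qnorm (signed_sum a D))"
          using IH by linarith
      qed (use kappa_ge_1 R in auto)
      also have "\<dots> = K * qnorm (signed_sum a D)"
        using kappa_ge_1 Cp_ge_1 by (simp add: R_def K_def field_simps)
      finally show ?thesis .
    qed simp
  qed
  then show ?thesis using K by blast
qed

end

subsection \<open>Superconservative bases\<close>

context M_basis
begin

text \<open>Democracy with arbitrary signs, restricted to pairs in which the smaller set lies to the
  left. It is the combinatorial link between the democracy functions and partial greediness.\<close>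

definition superconservative :: bool where
  "superconservative \<longleftrightarrow> (\<exists>C\<ge>0. \<forall>A B \<epsilon> \<delta>. finite A \<longrightarrow> finite B \<longrightarrow> A \<subseteq> {1..} \<longrightarrow> B \<subseteq> {1..} \<longrightarrow>
     (\<forall>i\<in>A. \<forall>j\<in>B. i < j) \<longrightarrow> card A \<le> card B \<longrightarrow> unimodular_on A \<epsilon> \<longrightarrow> unimodular_on B \<delta> \<longrightarrow>
     qnorm (signed_sum \<epsilon> A) \<le> C * qnorm (signed_sum \<delta> B))"

lemma partial_sum_eq: "partial_sum m x = signed_sum (\<lambda>n. es n x) {1..m}"
  by (simp add: partial_sum_def signed_sum_def)

lemma es_tail:
  assumes "n \<ge> 1"
  shows "es n (x - partial_sum m x) = (if n \<le> m then 0 else es n x)"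
  using assms es_signed_sum[of "{1..m}" n "\<lambda>n. es n x"] by (simp add: es_diff partial_sum_eq)

text \<open>Here \<open>x\<close> need not have finite support, so the ordering cannot be built from
  finite lists. Instead the positions at which \<pi> takes values beyond \<open>m\<close> are
  enumerated increasingly; on those indices the coefficients of the tail and of \<open>x\<close>
  agree. Injectivity makes the set of these positions infinite.\<close>

lemma greedy_ordering_tail:
  assumes \<pi>: "greedy_ordering x \<pi>"
  obtains \<sigma> k where "greedy_ordering (x - partial_sum m x) \<sigma>" "\<sigma> ` {1..k} = \<pi> ` {1..m} \<inter> {m<..}"
proof -
  define S where "S = {i. i \<ge> 1 \<and> \<pi> i > m}"
  have inj: "inj_on \<pi> {1..}" using \<pi> by (simp add: greedy_ordering_def)
  have "finite {i. i \<ge> 1 \<and> \<pi> i \<le> m}"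
  proof (rule finite_imageD)
    show "finite (\<pi> ` {i. i \<ge> 1 \<and> \<pi> i \<le> m})" by (rule finite_subset[of _ "{..m}"]) auto
    show "inj_on \<pi> {i. i \<ge> 1 \<and> \<pi> i \<le> m}" by (rule inj_on_subset[OF inj]) auto
  qed
  moreover have "{1..} = S \<union> {i. i \<ge> 1 \<and> \<pi> i \<le> m}" by (auto simp: S_def)
  ultimately have S: "infinite S" by (metis finite_Un infinite_Ici)
  define \<sigma> where "\<sigma> i = \<pi> (enumerate S (i - 1))" for i
  have en: "enumerate S j \<ge> 1" "\<pi> (enumerate S j) > m" for j
    using enumerate_in_set[OF S, of j] by (auto simp: S_def)
  have "\<sigma> ` {1..} \<subseteq> {1..}"
  proof safe
    fix i :: nat
    show "\<sigma> i \<ge> 1" using en(2)[of "i - 1"] by (simp add: \<sigma>_def)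
  qed
  moreover have "inj_on \<sigma> {1..}"
  proof (rule inj_onI)
    fix i j :: nat assume ij: "i \<in> {1..}" "j \<in> {1..}" "\<sigma> i = \<sigma> j"
    then have "enumerate S (i - 1) = enumerate S (j - 1)"
      using inj_onD[OF inj, of "enumerate S (i - 1)" "enumerate S (j - 1)"] en(1) by (simp add: \<sigma>_def)
    then have "i - 1 = j - 1" using inj_enumerate[OF S] by (simp add: inj_eq)
    then show "i = j" using ij by simp
  qed
  moreover have "supp (x - partial_sum m x) \<subseteq> \<sigma> ` {1..}"
  proof
    fix n assume n: "n \<in> supp (x - partial_sum m x)"
    then have n1: "n \<ge> 1" by (simp add: supp_def)
    have nm: "n > m" "n \<in> supp x" using n es_tail[OF n1, of x m] by (auto simp: supp_def split: if_splits)
    then obtain i where i: "i \<ge> 1" "n = \<pi> i" using \<pi> by (auto simp: greedy_ordering_def)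
    then have "i \<in> S" using nm by (simp add: S_def)
    then obtain j where "i = enumerate S j" using range_enumerate[OF S] by blast
    then have "n = \<sigma> (Suc j)" using i by (simp add: \<sigma>_def)
    then show "n \<in> \<sigma> ` {1..}" by auto
  qed
  moreover have "norm (es (\<sigma> j) (x - partial_sum m x)) \<le> norm (es (\<sigma> i) (x - partial_sum m x))"
    if ij: "1 \<le> i" "i \<le> j" for i j
  proof -
    have "es (\<sigma> i) (x - partial_sum m x) = es (\<sigma> i) x" for i
      using en(2)[of "i - 1"] es_tail[of "\<sigma> i" x m] by (simp add: \<sigma>_def)
    moreover have "enumerate S (i - 1) \<le> enumerate S (j - 1)"
      using ij enumerate_mono_le_iff[OF S] by simp
    then have "norm (es (\<sigma> j) x) \<le> norm (es (\<sigma> i) x)"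
      using \<pi> en(1)[of "i - 1"] by (simp add: greedy_ordering_def \<sigma>_def)
    ultimately show ?thesis by simp
  qed
  ultimately have "greedy_ordering (x - partial_sum m x) \<sigma>"
    unfolding greedy_ordering_def by auto
  \<comment> \<open>The number of enumerated positions that are at most \<open>m\<close>; it can be
    0.\<close>
  moreover define k where "k = (LEAST j. enumerate S j > m)"
  have "enumerate S (Suc m) > m" using le_enumerate[OF S, of "Suc m"] by simp
  then have k: "enumerate S k > m" unfolding k_def by (rule LeastI)
  have less: "enumerate S j \<le> m \<longleftrightarrow> j < k" for j
  proof
    assume "enumerate S j \<le> m"
    then show "j < k" using k enumerate_mono_le_iff[OF S, of k j] by (auto simp: not_le[symmetric])
  next
    assume "j < k"
    then show "enumerate S j \<le> m" unfolding k_def using not_less_Least by (metis not_le)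
  qed
  have "\<sigma> ` {1..k} = \<pi> ` {1..m} \<inter> {m<..}"
  proof (intro set_eqI iffI)
    fix n assume "n \<in> \<sigma> ` {1..k}"
    then obtain i where i: "1 \<le> i" "i \<le> k" "n = \<sigma> i" by auto
    then have "enumerate S (i - 1) \<le> m" using less by simp
    then show "n \<in> \<pi> ` {1..m} \<inter> {m<..}" using i en[of "i - 1"] by (auto simp: \<sigma>_def)
  next
    fix n assume "n \<in> \<pi> ` {1..m} \<inter> {m<..}"
    then obtain i where i: "1 \<le> i" "i \<le> m" "n = \<pi> i" "n > m" by auto
    then have "i \<in> S" by (simp add: S_def)
    then obtain j where j: "i = enumerate S j" using range_enumerate[OF S] by blast
    then have "j < k" using less i by simp
    then have "Suc j \<in> {1..k}" "n = \<sigma> (Suc j)" using i j by (auto simp: \<sigma>_def)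
    then show "n \<in> \<sigma> ` {1..k}" by blast
  qed
  ultimately show thesis by (rule that)
qed

end

section \<open>From superconservativity to partial greediness\<close>

context quasi_greedy_basis
begin

lemma qnorm_greedy_sum_tail:
  assumes \<pi>: "greedy_ordering x \<pi>"
  shows "qnorm (signed_sum (\<lambda>n. es n x) (\<pi> ` {1..m} \<inter> {m<..})) \<le> Cp * qnorm (x - partial_sum m x)"
proof -
  define y where "y = x - partial_sum m x"
  define B where "B = \<pi> ` {1..m} \<inter> {m<..}"
  obtain \<sigma> k where \<sigma>: "greedy_ordering y \<sigma>" "\<sigma> ` {1..k} = B"
    unfolding y_def B_def by (rule greedy_ordering_tail[OF \<pi>])
  show ?thesis
  \<comment> \<open>Split off because quasi-greediness is assumed for at least one greedy
    term.\<close>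
  proof (cases "k = 0")
    case True
    then have "B = {}" using \<sigma>(2) by simp
    then show ?thesis
      using Cp_ge_1 qnorm_nonneg[of y] unfolding B_def[symmetric] y_def[symmetric] by simp
  next
    case False
    have "inj_on \<sigma> {1..k}"
      using \<sigma>(1) by (auto simp: greedy_ordering_def intro: inj_on_subset)
    then have "(\<Sum>n=1..k. es (\<sigma> n) y \<cdot> e (\<sigma> n)) = (\<Sum>n\<in>B. es n y \<cdot> e n)"
      using sum.reindex[of \<sigma> "{1..k}" "\<lambda>n. es n y \<cdot> e n"] \<sigma>(2) by simp
    also have "\<dots> = signed_sum (\<lambda>n. es n x) B"
      unfolding signed_sum_def
    proof (intro sum.cong refl)
      fix n assume "n \<in> B"
      then have "n > m" by (simp add: B_def)
      then show "es n y \<cdot> e n = es n x \<cdot> e n" using es_tail[of n x m] by (simp add: y_def)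
    qed
    finally have eq: "(\<Sum>n=1..k. es (\<sigma> n) y \<cdot> e (\<sigma> n)) = signed_sum (\<lambda>n. es n x) B" .
    have "ennreal (qnorm (y - (\<Sum>n=1..k. es (\<sigma> n) y \<cdot> e (\<sigma> n)))) \<le> greedy_error k y"
      unfolding greedy_error_def by (rule SUP_upper) (use \<sigma>(1) in auto)
    also have "\<dots> \<le> ennreal (Cg * qnorm y)" using False by (intro greedy_error_le) simp
    finally have le: "qnorm (y - signed_sum (\<lambda>n. es n x) B) \<le> Cg * qnorm y"
      using Cg_ge_1 qnorm_nonneg unfolding eq by (simp add: ennreal_le_iff)
    have "qnorm (signed_sum (\<lambda>n. es n x) B) = qnorm (y - (y - signed_sum (\<lambda>n. es n x) B))" by simp
    also have "\<dots> \<le> kappa * (qnorm y + qnorm (y - signed_sum (\<lambda>n. es n x) B))" by (rule qnorm_diff)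
    also have "\<dots> \<le> kappa * (qnorm y + Cg * qnorm y)"
      using le kappa_ge_1 by (intro mult_left_mono add_left_mono) auto
    finally show ?thesis
      unfolding B_def[symmetric] y_def[symmetric] by (simp add: Cp_def algebra_simps)
  qed
qed

text \<open>The least modulus \<open>t\<close> on \<open>B\<close> separates the two sides. On
  \<open>D\<close> the coefficients are \<open>t\<close> times signs scaled by factors in
  \<open>{0..1}\<close>, controlled by sign sums over subsets of \<open>D\<close>;
  superconservativity moves these to \<open>B\<close>, where \<open>qnorm_sgn_le\<close> restores
  the coefficients \<open>a\<close>.\<close>

lemma qnorm_smaller_coefficients_le:
  assumes superconservative
  shows "\<exists>K\<ge>0. \<forall>D B a. finite D \<longrightarrow> finite B \<longrightarrow> D \<subseteq> {1..} \<longrightarrow> B \<subseteq> {1..} \<longrightarrow>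
     (\<forall>i\<in>D. \<forall>j\<in>B. i < j) \<longrightarrow> card D \<le> card B \<longrightarrow> (\<forall>i\<in>D. \<forall>j\<in>B. norm (a i) \<le> norm (a j)) \<longrightarrow>
     qnorm (signed_sum a D) \<le> K * qnorm (signed_sum a B)"
proof -
  obtain C where C: "C \<ge> 0" "\<And>A B \<epsilon> \<delta>. finite A \<Longrightarrow> finite B \<Longrightarrow> A \<subseteq> {1..} \<Longrightarrow> B \<subseteq> {1..} \<Longrightarrow>
     \<forall>i\<in>A. \<forall>j\<in>B. i < j \<Longrightarrow> card A \<le> card B \<Longrightarrow> unimodular_on A \<epsilon> \<Longrightarrow> unimodular_on B \<delta> \<Longrightarrow>
     qnorm (signed_sum \<epsilon> A) \<le> C * qnorm (signed_sum \<delta> B)"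
    using assms unfolding superconservative_def by blast
  obtain Kb where Kb: "Kb \<ge> 1" "\<And>D b \<epsilon> M. finite D \<Longrightarrow> D \<subseteq> {1..} \<Longrightarrow> \<forall>n\<in>D. b n \<in> {0..1} \<Longrightarrow>
     \<forall>D'\<subseteq>D. qnorm (signed_sum \<epsilon> D') \<le> M \<Longrightarrow>
     qnorm (signed_sum (\<lambda>n. of_real (b n) * \<epsilon> n) D) \<le> Kb * M"
    using qnorm_bounded_coefficients by blast
  obtain Ks where Ks: "Ks \<ge> 1" "\<And>D a s. finite D \<Longrightarrow> D \<subseteq> {1..} \<Longrightarrow> s > 0 \<Longrightarrow>
     \<forall>n\<in>D. s \<le> norm (a n) \<Longrightarrow>
     s * qnorm (signed_sum (\<lambda>n. sgn (a n)) D) \<le> Ks * qnorm (signed_sum a D)"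
    using qnorm_sgn_le by blast
  have bound: "qnorm (signed_sum a D) \<le> (Kb * C * Ks) * qnorm (signed_sum a B)"
    if D: "finite D" "D \<subseteq> {1..}" and B: "finite B" "B \<subseteq> {1..}" and DB: "\<forall>i\<in>D. \<forall>j\<in>B. i < j"
      and card: "card D \<le> card B" and le: "\<forall>i\<in>D. \<forall>j\<in>B. norm (a i) \<le> norm (a j)"
    for D B a
  proof (cases "\<forall>n\<in>D. a n = 0")
    case True
    then have "signed_sum a D = 0" by (simp add: signed_sum_def)
    then show ?thesis using Kb(1) C(1) Ks(1) qnorm_nonneg by simp
  next
    case False
    then have "D \<noteq> {}" by auto
    then have "B \<noteq> {}" using card D by (auto simp: card_gt_0_iff)
    define t where "t = Min ((\<lambda>n. norm (a n)) ` B)"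
    have "t \<in> (\<lambda>n. norm (a n)) ` B" unfolding t_def using B \<open>B \<noteq> {}\<close> by (intro Min_in) auto
    then obtain n0 where n0: "n0 \<in> B" "t = norm (a n0)" by auto
    have tB: "\<forall>n\<in>B. t \<le> norm (a n)" using B by (simp add: t_def)
    have tD: "norm (a n) \<le> t" if "n \<in> D" for n using le n0 that by simp
    have t: "t > 0" 
    proof -
      obtain n where "n \<in> D" "a n \<noteq> 0" using False by auto
      then have "0 < norm (a n)" "norm (a n) \<le> t" using tD by auto
      then show ?thesis by linarith
    qed
    \<comment> \<open>Since \<open>sgn 0 = 0\<close> is not unimodular, the sign 1 stands in at zero
      coefficients; the factor \<open>b n\<close> is 0 there.\<close>
    define \<epsilon> where "\<epsilon> n = (if a n = 0 then 1 else sgn (a n))" for n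
    define b where "b n = norm (a n) / t" for n
    have u: "unimodular_on X \<epsilon>" for X by (simp add: unimodular_on_def \<epsilon>_def norm_sgn)
    have uB: "unimodular_on B (\<lambda>n. sgn (a n))" using t tB by (auto simp: unimodular_on_def norm_sgn)
    let ?M = "C * qnorm (signed_sum (\<lambda>n. sgn (a n)) B)"
    have "qnorm (signed_sum (\<lambda>n. of_real (b n) * \<epsilon> n) D) \<le> Kb * ?M"
    proof (rule Kb(2)[OF D])
      show "\<forall>n\<in>D. b n \<in> {0..1}" using t tD by (simp add: b_def)
      show "\<forall>D'\<subseteq>D. qnorm (signed_sum \<epsilon> D') \<le> ?M"
      proof (intro allI impI)
        fix D' assume D': "D' \<subseteq> D"
        then have "card D' \<le> card B" using card card_mono[OF D(1) D'] by simp
        then show "qnorm (signed_sum \<epsilon> D') \<le> ?M"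
          using D' D B DB u uB finite_subset[OF D' D(1)] by (intro C(2)) auto
      qed
    qed
    moreover have "signed_sum a D = of_real t \<cdot> signed_sum (\<lambda>n. of_real (b n) * \<epsilon> n) D"
    proof -
      have "a n = of_real t * (of_real (b n) * \<epsilon> n)" for n
        using t of_real_norm_mult_sgn[of "a n"] by (auto simp: b_def \<epsilon>_def)
      then show ?thesis unfolding signed_sum_scale[symmetric] by (intro signed_sum_cong) auto
    qed
    ultimately have "qnorm (signed_sum a D) \<le> t * (Kb * ?M)"
      using t by (simp add: qnorm_scale)
    also have "\<dots> = Kb * C * (t * qnorm (signed_sum (\<lambda>n. sgn (a n)) B))" by simp
    also have "\<dots> \<le> Kb * C * (Ks * qnorm (signed_sum a B))"
      using Kb(1) C(1) by (intro mult_left_mono Ks(2) B t tB) auto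
    finally show ?thesis by simp
  qed
  have "Kb * C * Ks \<ge> 0" using Kb(1) C(1) Ks(1) by simp
  then show ?thesis by (intro exI[of _ "Kb * C * Ks"] conjI allI impI bound)
qed

lemma partially_greedy_if_superconservative:
  assumes superconservative
  shows partially_greedy
proof -
  obtain K where K: "K \<ge> 0" "\<And>D B a. finite D \<Longrightarrow> finite B \<Longrightarrow> D \<subseteq> {1..} \<Longrightarrow> B \<subseteq> {1..} \<Longrightarrow>
     \<forall>i\<in>D. \<forall>j\<in>B. i < j \<Longrightarrow> card D \<le> card B \<Longrightarrow> \<forall>i\<in>D. \<forall>j\<in>B. norm (a i) \<le> norm (a j) \<Longrightarrow>
     qnorm (signed_sum a D) \<le> K * qnorm (signed_sum a B)"
    using qnorm_smaller_coefficients_le[OF assms] by blast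
  define C where "C = kappa * (1 + kappa * (K + 1) * Cp)"
  have C: "C > 0"
  proof -
    have "kappa * (K + 1) * Cp \<ge> 0" using kappa_ge_1 K(1) Cp_ge_1 by simp
    then show ?thesis using kappa_ge_1 by (simp add: C_def add_pos_nonneg)
  qed
  have "qnorm (x - (\<Sum>n=1..m. es (\<pi> n) x \<cdot> e (\<pi> n))) \<le> C * qnorm (x - partial_sum m x)"
    if \<pi>: "greedy_ordering x \<pi>" for x m \<pi>
  proof -
    define a where "a n = es n x" for n
    define y where "y = x - partial_sum m x"
    define A where "A = \<pi> ` {1..m}"
    define B where "B = A \<inter> {m<..}"
    define D where "D = {1..m} - A"
    have inj: "inj_on \<pi> {1..m}"
      using \<pi> by (auto simp: greedy_ordering_def intro: inj_on_subset)
    have "\<pi> ` {1..} \<subseteq> {1..}" using \<pi> by (simp add: greedy_ordering_def)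
    then have A: "finite A" "A \<subseteq> {1..}" "card A = m"
      using card_image[OF inj] by (force simp: A_def)+
    have split: "A = (A \<inter> {1..m}) \<union> B" "{1..m} = (A \<inter> {1..m}) \<union> D"
      using A(2) by (auto simp: B_def D_def)
    have fin: "finite B" "finite D" "B \<subseteq> {1..}" "D \<subseteq> {1..}"
      using A by (auto simp: B_def D_def)
    have disj: "(A \<inter> {1..m}) \<inter> B = {}" "(A \<inter> {1..m}) \<inter> D = {}"
      by (auto simp: B_def D_def)
    have "card A = card (A \<inter> {1..m}) + card B"
      by (subst split(1), rule card_Un_disjoint) (use A fin disj in auto)
    moreover have "card {1..m} = card (A \<inter> {1..m}) + card D"
      by (subst split(2), rule card_Un_disjoint) (use A fin disj in auto)
    \<comment> \<open>\<open>A\<close> and \<open>{1..m}\<close> both have \<open>m\<close>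
      elements, so removing their intersection leaves sets of equal size.\<close>
    ultimately have card: "card D \<le> card B" using A(3) by simp
    have "(\<Sum>n=1..m. es (\<pi> n) x \<cdot> e (\<pi> n)) = signed_sum a A"
      using sum.reindex[OF inj, of "\<lambda>n. es n x \<cdot> e n"] by (simp add: signed_sum_def A_def a_def)
    also have "\<dots> = signed_sum a (A \<inter> {1..m}) + signed_sum a B"
      by (subst split(1), rule signed_sum_Un) (use A fin disj in auto)
    finally have sA: "(\<Sum>n=1..m. es (\<pi> n) x \<cdot> e (\<pi> n)) = signed_sum a (A \<inter> {1..m}) + signed_sum a B" .
    have "partial_sum m x = signed_sum a {1..m}" by (simp add: partial_sum_eq a_def[abs_def])
    also have "\<dots> = signed_sum a (A \<inter> {1..m}) + signed_sum a D"
      by (subst split(2), rule signed_sum_Un) (use A fin disj in auto)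
    finally have eq: "x - (\<Sum>n=1..m. es (\<pi> n) x \<cdot> e (\<pi> n)) = y + (signed_sum a D - signed_sum a B)"
      unfolding sA y_def by simp
    have B_le: "qnorm (signed_sum a B) \<le> Cp * qnorm y"
      using qnorm_greedy_sum_tail[OF \<pi>, of m] by (simp add: a_def[abs_def] y_def B_def A_def)
    \<comment> \<open>A support index outside \<open>A\<close> sits at a position beyond
      \<open>m\<close> in \<pi>, an index of \<open>B\<close> at one up to \<open>m\<close>. Indices
      with zero coefficient may be missing from \<pi> and are treated apart.\<close>
    have "norm (a i) \<le> norm (a j)" if ij: "i \<in> D" "j \<in> B" for i j
    proof (cases "a i = 0")
      case False
      then have "i \<in> supp x" using ij fin by (auto simp: supp_def a_def)
      then obtain i' where i': "i' \<ge> 1" "i = \<pi> i'" using \<pi> by (auto simp: greedy_ordering_def)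
      then have "i' > m" using ij by (auto simp: D_def A_def)
      moreover obtain j' where "1 \<le> j'" "j' \<le> m" "j = \<pi> j'" using ij by (auto simp: B_def A_def)
      ultimately show ?thesis using \<pi> i' by (auto simp: greedy_ordering_def a_def)
    qed simp
    then have D_le: "qnorm (signed_sum a D) \<le> K * qnorm (signed_sum a B)"
      using card fin by (intro K(2)) (auto simp: B_def D_def)
    have "qnorm (y + (signed_sum a D - signed_sum a B))
        \<le> kappa * (qnorm y + kappa * (qnorm (signed_sum a D) + qnorm (signed_sum a B)))"
      by (rule order_trans[OF qnorm_add]) (use kappa_ge_1 qnorm_diff in \<open>auto intro!: mult_left_mono\<close>)
    also have "\<dots> \<le> kappa * (qnorm y + kappa * (K * qnorm (signed_sum a B) + qnorm (signed_sum a B)))"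
      using D_le kappa_ge_1 by (intro mult_left_mono add_mono) auto
    also have "\<dots> = kappa * (qnorm y + kappa * (K + 1) * qnorm (signed_sum a B))"
      by (simp add: algebra_simps)
    also have "\<dots> \<le> kappa * (qnorm y + kappa * (K + 1) * (Cp * qnorm y))"
      using B_le kappa_ge_1 K(1) by (intro mult_left_mono add_mono) auto
    finally show ?thesis unfolding eq y_def[symmetric] by (simp add: C_def algebra_simps)
  qed
  then have "greedy_error m x \<le> ennreal C * partial_error m x" for m x
    unfolding greedy_error_def partial_error_def
    using C by (auto intro!: SUP_least ennreal_leI simp: ennreal_mult'[symmetric])
  then show ?thesis unfolding partially_greedy_def using C by blast
qed

end

subsection \<open>Superconservativity from the embedding\<close>

context quasi_greedy_basis
begin

text \<open>
  The embedding is tested on the signed sum over \<open>{1..N} \<union> B\<close>: greedy approximation may remove \<open>B\<close>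
  first, partial sums remove \<open>{1..N}\<close> first.
\<close>

lemma embedding_test:
  assumes w: "weight \<omega>" and i: "lower_dilation_index \<omega> > 0" and q: "q > 0"
    and emb: "PG_embeds_G q \<omega>"
  shows "\<exists>C>0. \<forall>N p L B \<epsilon>. 1 \<le> N \<longrightarrow> 1 \<le> p \<longrightarrow> 1 \<le> L \<longrightarrow> B \<subseteq> {N<..L} \<longrightarrow> 2 * p \<le> card B \<longrightarrow>
    unimodular_on ({1..N} \<union> B) \<epsilon> \<longrightarrow>
    \<omega> p * qnorm (signed_sum \<epsilon> {1..N})
      \<le> C * (\<omega> N * (qnorm (signed_sum \<epsilon> {1..N}) + qnorm (signed_sum \<epsilon> B)) + \<omega> L * qnorm (signed_sum \<epsilon> B))"
proof -
  obtain c where c: "c > 0" "\<And>p g \<gamma>. p \<ge> 1 \<Longrightarrow> g \<ge> 0 \<Longrightarrow> \<forall>n\<in>{p..<2*p}. ennreal g \<le> \<gamma> n \<Longrightarrow>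
    ennreal (c * (\<omega> p * g)) \<le> weighted_lq q \<omega> \<gamma>"
    using weighted_lq_lower[OF w q] by blast
  obtain K where K: "K > 0" "\<And>N L a b \<beta>. N \<ge> 1 \<Longrightarrow> L \<ge> 1 \<Longrightarrow> a \<ge> 0 \<Longrightarrow> b \<ge> 0 \<Longrightarrow>
    \<forall>n\<ge>1. \<beta> n \<le> ennreal ((if n \<le> N then a else 0) + (if n \<le> L then b else 0)) \<Longrightarrow>
    weighted_lq q \<omega> \<beta> \<le> ennreal (K * (\<omega> N * a + \<omega> L * b))"
    using weighted_lq_upper[OF w i q] by blast
  obtain E where E: "E > 0" "\<And>x. x \<in> PG_class q \<omega> \<Longrightarrow> G_norm q \<omega> x \<le> ennreal E * PG_norm q \<omega> x"
    using emb unfolding PG_embeds_G_def embeds_def by blast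
  define C where "C = Cg / c * (E * (kappa / \<omega> 1 + K * kappa * Cg + K * Cg))"
  have w1: "\<omega> 1 > 0" using w by (simp add: weight_def)
  have C: "C > 0"
  proof -
    have "kappa / \<omega> 1 + K * kappa * Cg + K * Cg > 0"
      using kappa_ge_1 w1 K(1) Cg_ge_1 by (intro add_pos_pos mult_pos_pos divide_pos_pos) auto
    then show ?thesis using c(1) Cg_ge_1 E(1) by (simp add: C_def)
  qed
  have "\<omega> p * qnorm (signed_sum \<epsilon> {1..N})
      \<le> C * (\<omega> N * (qnorm (signed_sum \<epsilon> {1..N}) + qnorm (signed_sum \<epsilon> B)) + \<omega> L * qnorm (signed_sum \<epsilon> B))"
    if N: "1 \<le> N" and p: "1 \<le> p" and L: "1 \<le> L" and B: "B \<subseteq> {N<..L}" and pB: "2 * p \<le> card B"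
      and u: "unimodular_on ({1..N} \<union> B) \<epsilon>" for N p L B \<epsilon>
  proof -
    define F where "F = {1..N} \<union> B"
    define x where "x = signed_sum \<epsilon> F"
    define \<alpha> where "\<alpha> = qnorm (signed_sum \<epsilon> {1..N})"
    define b where "b = qnorm (signed_sum \<epsilon> B)"
    have \<alpha>b: "\<alpha> \<ge> 0" "b \<ge> 0" by (simp_all add: \<alpha>_def b_def qnorm_nonneg)
    have fB: "finite B" using B by (rule finite_subset) simp
    have B1: "B \<subseteq> {1..}" using B by auto
    have F: "finite F" "F \<subseteq> {1..}" using fB B1 by (auto simp: F_def)
    have uF: "unimodular_on F \<epsilon>" using u by (simp add: F_def)
    have "signed_sum \<epsilon> F = signed_sum \<epsilon> {1..N} + signed_sum \<epsilon> B"
      unfolding F_def by (rule signed_sum_Un) (use B fB in auto)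
    then have x_le: "qnorm x \<le> kappa * (\<alpha> + b)"
      unfolding x_def \<alpha>_def b_def by (metis qnorm_add)
    \<comment> \<open>Any \<open>n\<close> elements of \<open>B\<close> form a greedy set by ties,
      and \<open>n < 2 * p \<le> card B\<close> guarantees that they exist. What remains still
      contains \<open>{1..N}\<close>.\<close>
    have "ennreal (\<alpha> / Cg) \<le> greedy_error n x" if n: "n \<in> {p..<2*p}" for n
    proof -
      have "n \<le> card B" using n pB by simp
      then obtain B' where B': "B' \<subseteq> B" "card B' = n" "finite B'"
        by (rule obtain_subset_with_card_n)
      have "ennreal (qnorm (signed_sum \<epsilon> (F - B'))) \<le> greedy_error (card B') x"
        unfolding x_def using B'(1) uF
        by (intro greedy_error_ge_of_greedy_set F) (auto simp: F_def unimodular_on_def)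
      moreover have "\<alpha> \<le> Cg * qnorm (signed_sum \<epsilon> (F - B'))"
        unfolding \<alpha>_def
      proof (rule qnorm_signed_sum_subset)
        show "{1..N} \<subseteq> F - B'" using B' B by (auto simp: F_def)
        show "unimodular_on (F - B') \<epsilon>" using uF by (rule unimodular_on_subset) auto
      qed (use F in auto)
      then have "ennreal (\<alpha> / Cg) \<le> ennreal (qnorm (signed_sum \<epsilon> (F - B')))"
        using Cg_ge_1 by (intro ennreal_leI) (simp add: pos_divide_le_eq mult.commute)
      ultimately show ?thesis using B'(2) by (simp add: order_trans)
    qed
    then have "ennreal (c * (\<omega> p * (\<alpha> / Cg))) \<le> weighted_lq q \<omega> (\<lambda>n. greedy_error n x)"
      using p \<alpha>b Cg_ge_1 by (intro c(2)) auto
    also have "\<dots> \<le> G_norm q \<omega> x" by (simp add: G_norm_def)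
    finally have G_ge: "ennreal (c * (\<omega> p * (\<alpha> / Cg))) \<le> G_norm q \<omega> x" .
    \<comment> \<open>Up to \<open>N\<close> the remaining tail is a subset of \<open>F\<close>,
      afterwards a subset of \<open>B\<close>, and beyond \<open>L\<close> it is empty;
      \<open>a'\<close> and \<open>b'\<close> bound its norm in the first two ranges.\<close>
    define a' b' where "a' = Cg * (kappa * (\<alpha> + b))" and "b' = Cg * b"
    have ab': "a' \<ge> 0" "b' \<ge> 0" using \<alpha>b Cg_ge_1 kappa_ge_1 by (auto simp: a'_def b'_def)
    have "partial_error n x \<le> ennreal ((if n \<le> N then a' else 0) + (if n \<le> L then b' else 0))"
      if n: "n \<ge> 1" for n
    proof -
      have "es i x = (if i \<in> F then \<epsilon> i else 0)" if "i \<ge> 1" for i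
        unfolding x_def by (rule es_signed_sum[OF F that])
      then have "partial_sum n x = signed_sum \<epsilon> (F \<inter> {1..n})"
        unfolding partial_sum_eq signed_sum_def
        by (intro sum.mono_neutral_cong_right) auto
      then have "x - partial_sum n x = signed_sum \<epsilon> (F - F \<inter> {1..n})"
        using signed_sum_Diff[OF F(1), of "F \<inter> {1..n}"] by (simp add: x_def)
      moreover have "qnorm (signed_sum \<epsilon> (F - F \<inter> {1..n}))
          \<le> (if n \<le> N then a' else 0) + (if n \<le> L then b' else 0)"
      proof (cases "n \<le> N")
        case True
        have "qnorm (signed_sum \<epsilon> (F - F \<inter> {1..n})) \<le> Cg * qnorm x"
          unfolding x_def using uF by (intro qnorm_signed_sum_subset F) auto
        also have "\<dots> \<le> a'" unfolding a'_def using x_le Cg_ge_1 by (intro mult_left_mono) auto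
        finally show ?thesis using True ab' by simp
      next
        case False
        have sub: "F - F \<inter> {1..n} \<subseteq> B" using False by (auto simp: F_def)
        show ?thesis
        proof (cases "n \<le> L")
          case True
          have "qnorm (signed_sum \<epsilon> (F - F \<inter> {1..n})) \<le> b'"
            unfolding b'_def b_def using uF
            by (intro qnorm_signed_sum_subset fB B1 sub) (auto simp: F_def intro: unimodular_on_subset)
          then show ?thesis using True False by simp
        next
          case nL: False
          have "F - F \<inter> {1..n} = {}" using nL False B by (auto simp: F_def)
          then show ?thesis using nL False by (simp only: signed_sum_empty) simp
        qed
      qed
      ultimately show ?thesis unfolding partial_error_def by (simp add: ennreal_leI)
    qed
    then have "weighted_lq q \<omega> (\<lambda>n. partial_error n x) \<le> ennreal (K * (\<omega> N * a' + \<omega> L * b'))"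
      by (intro K(2) N L ab') blast
    then have "PG_norm q \<omega> x \<le> ennreal (kappa * (\<alpha> + b)) + ennreal (K * (\<omega> N * a' + \<omega> L * b'))"
      unfolding PG_norm_def by (intro add_mono ennreal_leI x_le)
    also have "\<dots> = ennreal (kappa * (\<alpha> + b) + K * (\<omega> N * a' + \<omega> L * b'))"
      using kappa_ge_1 \<alpha>b ab' K(1) weight_pos[OF w N] weight_pos[OF w L]
      by (intro ennreal_plus[symmetric]) auto
    finally have PG: "PG_norm q \<omega> x \<le> ennreal (kappa * (\<alpha> + b) + K * (\<omega> N * a' + \<omega> L * b'))" .
    then have "x \<in> PG_class q \<omega>"
      using le_less_trans[OF PG ennreal_less_top] by (simp add: PG_class_def)
    have "ennreal (c * (\<omega> p * (\<alpha> / Cg))) \<le> ennreal E * PG_norm q \<omega> x"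
      using G_ge E(2)[OF \<open>x \<in> PG_class q \<omega>\<close>] by (rule order_trans)
    also have "\<dots> \<le> ennreal E * ennreal (kappa * (\<alpha> + b) + K * (\<omega> N * a' + \<omega> L * b'))"
      using PG by (intro mult_left_mono) auto
    also have "\<dots> = ennreal (E * (kappa * (\<alpha> + b) + K * (\<omega> N * a' + \<omega> L * b')))"
      using E(1) by (simp add: ennreal_mult')
    finally have "c * (\<omega> p * (\<alpha> / Cg)) \<le> E * (kappa * (\<alpha> + b) + K * (\<omega> N * a' + \<omega> L * b'))"
      using E(1) kappa_ge_1 \<alpha>b ab' K(1) weight_pos[OF w N] weight_pos[OF w L]
      by (subst (asm) ennreal_le_iff) auto
    also have "\<dots> \<le> E * ((kappa / \<omega> 1 + K * kappa * Cg + K * Cg) * (\<omega> N * (\<alpha> + b) + \<omega> L * b))"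
    proof (rule mult_left_mono)
      \<comment> \<open>The plain norm in \<open>PG_norm\<close> carries no weight; since
        \<open>\<omega> 1 \<le> \<omega> N\<close> it is absorbed into the weighted term at the
        price of \<open>1 / \<omega> 1\<close>.\<close>
      have "kappa * (\<alpha> + b) = kappa / \<omega> 1 * (\<omega> 1 * (\<alpha> + b))" using w1 by simp
      also have "\<dots> \<le> kappa / \<omega> 1 * (\<omega> N * (\<alpha> + b) + \<omega> L * b)"
      proof (rule mult_left_mono)
        have "\<omega> 1 * (\<alpha> + b) \<le> \<omega> N * (\<alpha> + b)"
          using weight_mono[OF w _ N] \<alpha>b by (intro mult_right_mono) auto
        then show "\<omega> 1 * (\<alpha> + b) \<le> \<omega> N * (\<alpha> + b) + \<omega> L * b"
          using weight_pos[OF w L] \<alpha>b by (simp add: add_increasing2)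
      qed (use kappa_ge_1 w1 in auto)
      moreover have "K * (\<omega> N * a') \<le> K * kappa * Cg * (\<omega> N * (\<alpha> + b) + \<omega> L * b)"
      proof -
        have "K * (\<omega> N * a') = K * kappa * Cg * (\<omega> N * (\<alpha> + b))" by (simp add: a'_def)
        also have "\<dots> \<le> K * kappa * Cg * (\<omega> N * (\<alpha> + b) + \<omega> L * b)"
          using K(1) kappa_ge_1 Cg_ge_1 weight_pos[OF w L] \<alpha>b by (intro mult_left_mono) auto
        finally show ?thesis .
      qed
      moreover have "K * (\<omega> L * b') \<le> K * Cg * (\<omega> N * (\<alpha> + b) + \<omega> L * b)"
      proof -
        have "K * (\<omega> L * b') = K * Cg * (\<omega> L * b)" by (simp add: b'_def)
        also have "\<dots> \<le> K * Cg * (\<omega> N * (\<alpha> + b) + \<omega> L * b)"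
          using K(1) Cg_ge_1 weight_pos[OF w N] \<alpha>b by (intro mult_left_mono) auto
        finally show ?thesis .
      qed
      ultimately show "kappa * (\<alpha> + b) + K * (\<omega> N * a' + \<omega> L * b')
          \<le> (kappa / \<omega> 1 + K * kappa * Cg + K * Cg) * (\<omega> N * (\<alpha> + b) + \<omega> L * b)"
        unfolding distrib_right[of _ _ "\<omega> N * (\<alpha> + b) + \<omega> L * b"] distrib_left[of K] by linarith
    qed (use E(1) in auto)
    finally have "Cg / c * (c * (\<omega> p * (\<alpha> / Cg))) \<le> C * (\<omega> N * (\<alpha> + b) + \<omega> L * b)"
      unfolding C_def mult.assoc[of "Cg / c"] mult.assoc[of E] using Cg_ge_1 c(1) by (intro mult_left_mono) auto
    moreover have "Cg / c * (c * (\<omega> p * (\<alpha> / Cg))) = \<omega> p * \<alpha>"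
      using Cg_ge_1 c(1) by simp
    ultimately show ?thesis by (simp add: \<alpha>_def b_def)
  qed
  then show ?thesis using C by blast
qed

section \<open>Initial segments against the democracy functions\<close>

lemma h_l_le_h_Rr: "h_l m \<le> h_Rr m u"
  unfolding h_l_def h_Rr_def by (intro INF_superset_mono) auto

lemma h_Rr_le:
  assumes "B \<subseteq> {u<..}" "finite B" "card B = m" "unimodular_on B \<delta>"
  shows "h_Rr m u \<le> ennreal (qnorm (signed_sum \<delta> B))"
  unfolding h_Rr_def using assms by (intro INF_lower2[of "(B, \<delta>)"]) auto

text \<open>Degenerate denominators agree with the conventions of \<open>ennreal\<close>: if
  \<open>b = 0\<close>, a nonzero \<open>a\<close> would make the quotient \<open>top\<close>; if
  \<open>b = top\<close>, the right-hand side is \<open>top\<close>.\<close>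

lemma le_mult_of_divide_le_ennreal:
  fixes a b t :: ennreal
  assumes "a / b \<le> t" "t \<noteq> top" "t \<noteq> 0"
  shows "a \<le> t * b"
proof (cases "b = 0 \<or> b = top")
  case True
  then show ?thesis
    using assms by (cases "a = 0") (auto simp: ennreal_divide_zero ennreal_mult_top top_unique)
next
  case False
  then have "a = a / b * b"
    by (simp add: ennreal_divide_times less_top zero_less_iff_neq_zero)
  also have "\<dots> \<le> t * b" using assms(1) by (intro mult_right_mono) auto
  finally show ?thesis .
qed

lemma h_Rr_power:
  assumes property_I
  shows "\<exists>T\<ge>1. \<forall>u\<ge>1. \<forall>l. h_Rr (2 ^ l * u) u \<le> ennreal (T ^ l) * h_Rr u u"
proof -
  define S where "S = (SUP (l, u)\<in>UNIV \<times> {1..}. h_Rr (2 ^ (l + 1) * u) u / h_Rr (2 ^ l * u) u)"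
  have S: "S < top" using assms by (simp add: property_I_def S_def)
  \<comment> \<open>Adding 1 keeps the factor nonzero, as clearing the denominator requires.\<close>
  define T where "T = enn2real S + 1"
  have T: "T \<ge> 1" by (simp add: T_def)
  have ST: "S \<le> ennreal T" using S by (simp add: T_def ennreal_plus)
  have step: "h_Rr (2 ^ (l + 1) * u) u \<le> ennreal T * h_Rr (2 ^ l * u) u" if "u \<ge> 1" for l u
  proof (rule le_mult_of_divide_le_ennreal)
    have "h_Rr (2 ^ (l + 1) * u) u / h_Rr (2 ^ l * u) u \<le> S"
      unfolding S_def using that by (intro SUP_upper2[of "(l, u)"]) auto
    then show "h_Rr (2 ^ (l + 1) * u) u / h_Rr (2 ^ l * u) u \<le> ennreal T" using ST by (rule order_trans)
  qed (use T in auto)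
  have "h_Rr (2 ^ l * u) u \<le> ennreal (T ^ l) * h_Rr u u" if u: "u \<ge> 1" for l u
  proof (induction l)
    case (Suc l)
    have "h_Rr (2 ^ Suc l * u) u \<le> ennreal T * h_Rr (2 ^ l * u) u" using step[OF u, of l] by simp
    also have "\<dots> \<le> ennreal T * (ennreal (T ^ l) * h_Rr u u)" using Suc by (intro mult_left_mono) auto
    also have "\<dots> = ennreal (T ^ Suc l) * h_Rr u u"
      using T by (simp add: ennreal_mult' mult.assoc)
    finally show ?case .
  qed simp
  then show ?thesis using T by blast
qed

lemma initial_segment_le_h_Rr:
  assumes d: "doubling_weight \<omega>" and i: "lower_dilation_index \<omega> > 0" and q: "q > 0"
    and emb: "PG_embeds_G q \<omega>" and I: property_I and W: property_W_star
  shows "\<exists>C>0. \<forall>N\<ge>1. \<forall>\<epsilon>. unimodular_on {1..N} \<epsilon> \<longrightarrow>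
    ennreal (qnorm (signed_sum \<epsilon> {1..N})) \<le> ennreal C * h_Rr N N"
proof -
  have w: "weight \<omega>" using d by (simp add: doubling_weight_def)
  obtain \<theta> where \<theta>: "\<theta> \<ge> 1" "\<And>n. n \<ge> 1 \<Longrightarrow> \<omega> (2 * n) \<le> \<theta> * \<omega> n"
    using d by (auto simp: doubling_weight_def)
  obtain C where C: "C > 0" "\<And>N p L B \<epsilon>. 1 \<le> N \<Longrightarrow> 1 \<le> p \<Longrightarrow> 1 \<le> L \<Longrightarrow> B \<subseteq> {N<..L} \<Longrightarrow> 2 * p \<le> card B \<Longrightarrow>
    unimodular_on ({1..N} \<union> B) \<epsilon> \<Longrightarrow>
    \<omega> p * qnorm (signed_sum \<epsilon> {1..N})
      \<le> C * (\<omega> N * (qnorm (signed_sum \<epsilon> {1..N}) + qnorm (signed_sum \<epsilon> B)) + \<omega> L * qnorm (signed_sum \<epsilon> B))"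
    using embedding_test[OF w i q emb] by blast
  \<comment> \<open>This factor makes \<open>C * \<omega> N\<close> at most half of
    \<open>\<omega> (2 ^ l * N)\<close>, which permits the absorption below; \<open>l\<close> is
    fixed before \<open>N\<close>.\<close>
  obtain l where l: "\<And>k. k \<ge> 1 \<Longrightarrow> (2 * C) * \<omega> k \<le> \<omega> (2 ^ l * k)"
    using weight_power_growth[OF w i] by blast
  obtain T where T: "T \<ge> 1" "\<And>u l. u \<ge> 1 \<Longrightarrow> h_Rr (2 ^ l * u) u \<le> ennreal (T ^ l) * h_Rr u u"
    using h_Rr_power[OF I] by blast
  obtain C1 C2 where C12: "C1 > 0" "C2 > 0" "\<And>m. m \<ge> 1 \<Longrightarrow> \<exists>A \<epsilon>.
        A \<subseteq> {n. 1 \<le> n \<and> real n \<le> C1 * real m} \<and> card A = m \<and> unimodular_on A \<epsilon> \<and>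
        ennreal (qnorm (signed_sum \<epsilon> A)) \<le> ennreal C2 * h_l m"
    using W unfolding property_W_star_def by blast
  \<comment> \<open>The test set lies below \<open>C1 * (4 * p)\<close>, so \<open>s\<close>
    doublings of \<open>p\<close> reach its right end \<open>L\<close>.\<close>
  obtain s where s: "4 * C1 < 2 ^ s" using real_arch_pow[of 2 "4 * C1"] by auto
  define D where "D = 2 * C * (1 + \<theta> ^ s) * Cg"
  have D: "D > 0" using C(1) \<theta>(1) Cg_ge_1 by (simp add: D_def add_pos_pos)
  have "ennreal (qnorm (signed_sum \<epsilon> {1..N})) \<le> ennreal (D * C2 * T ^ (l + 2)) * h_Rr N N"
    if N: "N \<ge> 1" and u: "unimodular_on {1..N} \<epsilon>" for N \<epsilon>
  proof -
    define p where "p = 2 ^ l * N"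
    \<comment> \<open>Deleting the at most \<open>N \<le> p\<close> indices in \<open>{1..N}\<close>
      leaves at least \<open>3 * p\<close> elements, enough for the \<open>2 * p\<close> that the
      embedding test demands.\<close>
    define m where "m = 4 * p"
    have p1: "p \<ge> 1" and Np: "N \<le> p" using N by (simp_all add: p_def)
    have "m \<ge> 1" using p1 by (simp add: m_def)
    from C12(3)[OF this] obtain A \<delta> where
      A: "A \<subseteq> {n. 1 \<le> n \<and> real n \<le> C1 * real m}" "card A = m" "unimodular_on A \<delta>"
         "ennreal (qnorm (signed_sum \<delta> A)) \<le> ennreal C2 * h_l m"
      by blast
    have fA: "finite A" using A(2) \<open>m \<ge> 1\<close> by (intro card_ge_0_finite) simp
    define B where "B = A - {1..N}"
    define L where "L = nat \<lfloor>C1 * real m\<rfloor>"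
    define \<eta> where "\<eta> n = (if n \<le> N then \<epsilon> n else \<delta> n)" for n
    have B: "B \<subseteq> {N<..L}"
    proof
      fix n assume "n \<in> B"
      then have "1 \<le> n" "n \<notin> {1..N}" "real n \<le> C1 * real m" using A(1) by (auto simp: B_def)
      then show "n \<in> {N<..L}" by (auto simp: L_def le_nat_floor)
    qed
    have cB: "2 * p \<le> card B"
      using diff_card_le_card_Diff[of "{1..N}" A] Np A(2) by (simp add: B_def m_def)
    then have "B \<noteq> {}" using p1 by auto
    then have L1: "L \<ge> 1" using B N by fastforce
    have u\<eta>: "unimodular_on ({1..N} \<union> B) \<eta>"
      using u A(1,3) by (auto simp: unimodular_on_def \<eta>_def B_def)
    have \<eta>N: "signed_sum \<eta> {1..N} = signed_sum \<epsilon> {1..N}"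
      by (intro signed_sum_cong) (auto simp: \<eta>_def)
    have \<eta>B: "signed_sum \<eta> B = signed_sum \<delta> B"
      using B by (intro signed_sum_cong) (auto simp: \<eta>_def)
    define \<alpha> where "\<alpha> = qnorm (signed_sum \<epsilon> {1..N})"
    define b where "b = qnorm (signed_sum \<delta> B)"
    have \<alpha>b: "\<alpha> \<ge> 0" "b \<ge> 0" by (simp_all add: \<alpha>_def b_def qnorm_nonneg)
    have \<omega>p: "\<omega> p > 0" by (rule weight_pos[OF w p1])
    have test: "\<omega> p * \<alpha> \<le> C * (\<omega> N * (\<alpha> + b) + \<omega> L * b)"
      using C(2)[OF N p1 L1 B cB u\<eta>] by (simp only: \<eta>N \<eta>B \<alpha>_def b_def)
    have absorb: "C * \<omega> N * \<alpha> \<le> \<omega> p / 2 * \<alpha>"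
      using l[OF N] \<alpha>b by (intro mult_right_mono) (auto simp: p_def)
    have \<omega>N: "\<omega> N \<le> \<omega> p" by (rule weight_mono[OF w N Np])
    have "L \<le> 2 ^ s * p"
    proof -
      have "real L \<le> C1 * real m" using C12(1) by (simp add: L_def)
      also have "\<dots> = 4 * C1 * real p" by (simp add: m_def)
      also have "\<dots> \<le> 2 ^ s * real p" using s by (intro mult_right_mono) auto
      finally have "real L \<le> real (2 ^ s * p)" by simp
      then show ?thesis by (simp only: of_nat_le_iff)
    qed
    then have "\<omega> L \<le> \<omega> (2 ^ s * p)" by (rule weight_mono[OF w L1])
    also have "\<dots> \<le> \<theta> ^ s * \<omega> p" by (rule doubling_weight_power) (use \<theta> p1 in auto)
    finally have \<omega>L: "\<omega> L \<le> \<theta> ^ s * \<omega> p" .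
    have "\<omega> p * \<alpha> \<le> 2 * C * (\<omega> N + \<omega> L) * b"
      using test absorb by (simp add: algebra_simps)
    also have "\<dots> \<le> 2 * C * (\<omega> p + \<theta> ^ s * \<omega> p) * b"
      using \<omega>N \<omega>L C(1) \<alpha>b by (intro mult_right_mono mult_left_mono add_mono) auto
    finally have "\<omega> p * \<alpha> \<le> \<omega> p * (2 * C * (1 + \<theta> ^ s) * b)" by (simp add: algebra_simps)
    then have "\<alpha> \<le> 2 * C * (1 + \<theta> ^ s) * b" using \<omega>p by simp
    also have "\<dots> \<le> 2 * C * (1 + \<theta> ^ s) * (Cg * qnorm (signed_sum \<delta> A))"
    proof (rule mult_left_mono)
      show "b \<le> Cg * qnorm (signed_sum \<delta> A)"
        unfolding b_def using A fA by (intro qnorm_signed_sum_subset) (auto simp: B_def)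
    qed (use C(1) \<theta>(1) in auto)
    finally have "\<alpha> \<le> D * qnorm (signed_sum \<delta> A)" by (simp add: D_def mult.assoc)
    then have "ennreal \<alpha> \<le> ennreal D * ennreal (qnorm (signed_sum \<delta> A))"
      using D by (simp add: ennreal_mult'[symmetric] ennreal_leI)
    also have "\<dots> \<le> ennreal D * (ennreal C2 * h_l m)"
      by (rule mult_left_mono[OF A(4)]) simp
    \<comment> \<open>Sets beyond \<open>N\<close> of size \<open>m\<close> compete in the infimum
      \<open>h_l m\<close>, so it is at most \<open>h_Rr m N\<close>; as
      \<open>m = 2 ^ (l + 2) * N\<close>, the size can then be reduced to \<open>N\<close>.\<close>
    also have "\<dots> \<le> ennreal D * (ennreal C2 * (ennreal (T ^ (l + 2)) * h_Rr N N))"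
    proof (intro mult_left_mono)
      have "m = 2 ^ (l + 2) * N" by (simp add: m_def p_def)
      then show "h_l m \<le> ennreal (T ^ (l + 2)) * h_Rr N N"
        using h_l_le_h_Rr[of m N] T(2)[OF N, of "l + 2"] by (metis order_trans)
    qed auto
    also have "\<dots> = ennreal (D * C2 * T ^ (l + 2)) * h_Rr N N"
      using D C12(2) T(1) by (simp add: ennreal_mult' mult.assoc)
    finally show ?thesis by (simp add: \<alpha>_def)
  qed
  moreover have "D * C2 * T ^ (l + 2) > 0" using D C12(2) T(1) by simp
  ultimately show ?thesis by blast
qed

text \<open>If \<open>max A \<le> \<psi> (card A)\<close>, then \<open>A\<close> sits in an initial
  segment that is bounded by \<open>h_Rr\<close> on the diagonal, and the second half of Property
  (I) lowers the size to \<open>card A\<close>. If \<open>A\<close> reaches further, the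
  characteristic function replaces it by sets inside \<open>{1..\<psi> (card A)}\<close>, which
  brings back the first situation.\<close>

lemma superconservative_if_embedding:
  assumes d: "doubling_weight \<omega>" and i: "lower_dilation_index \<omega> > 0" and q: "q > 0"
    and emb: "PG_embeds_G q \<omega>" and I: property_I and W: property_W_star
  shows superconservative
proof -
  obtain D where D: "D > 0" "\<And>N \<epsilon>. N \<ge> 1 \<Longrightarrow> unimodular_on {1..N} \<epsilon> \<Longrightarrow>
    ennreal (qnorm (signed_sum \<epsilon> {1..N})) \<le> ennreal D * h_Rr N N"
    using initial_segment_le_h_Rr[OF assms] by blast
  obtain \<psi> C C' where \<psi>: "\<And>n. n \<ge> 1 \<Longrightarrow> n \<le> \<psi> n"
    and C: "C > 0" "\<And>m. m \<ge> 1 \<Longrightarrow> (SUP u\<in>{m..}. h_Rl m u) \<le> ennreal C * h_Rl m (\<psi> m)"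
    and C': "C' > 0" "\<And>m u. m \<ge> 1 \<Longrightarrow> u \<ge> 1 \<Longrightarrow> u \<le> \<psi> m \<Longrightarrow> h_Rr u u \<le> ennreal C' * h_Rr m u"
    using I unfolding property_I_def characteristic_function_def by blast
  define K where "K = Cg * D * C' * Cg"
  have K: "K > 0" using Cg_ge_1 D(1) C'(1) by (simp add: K_def)
  have diagonal: "qnorm (signed_sum \<epsilon> A) \<le> K * qnorm (signed_sum \<delta> B)"
    if v: "1 \<le> v" "1 \<le> m" "v \<le> \<psi> m" and A: "A \<subseteq> {1..v}" "unimodular_on A \<epsilon>"
      and B: "B \<subseteq> {v<..}" "finite B" "m \<le> card B" "unimodular_on B \<delta>" for v m A B \<epsilon> \<delta>
  proof -
    obtain B' where B': "B' \<subseteq> B" "card B' = m" "finite B'"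
      using B(3) by (rule obtain_subset_with_card_n)
    \<comment> \<open>Extending the signs by 1 makes \<open>A\<close> a subset of the support of a
      unimodular sum over the whole segment.\<close>
    define \<eta> where "\<eta> n = (if n \<in> A then \<epsilon> n else 1)" for n
    have \<eta>: "unimodular_on {1..v} \<eta>" using A(2) by (auto simp: unimodular_on_def \<eta>_def)
    have "signed_sum \<epsilon> A = signed_sum \<eta> A" by (intro signed_sum_cong) (auto simp: \<eta>_def)
    then have A_le: "qnorm (signed_sum \<epsilon> A) \<le> Cg * qnorm (signed_sum \<eta> {1..v})"
      using A(1) \<eta> qnorm_signed_sum_subset[of "{1..v}" A \<eta>] by simp
    have B_le: "qnorm (signed_sum \<delta> B') \<le> Cg * qnorm (signed_sum \<delta> B)"
      using B B'(1) v by (intro qnorm_signed_sum_subset) auto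
    have "ennreal (qnorm (signed_sum \<eta> {1..v})) \<le> ennreal D * h_Rr v v" by (rule D(2)[OF v(1) \<eta>])
    also have "\<dots> \<le> ennreal D * (ennreal C' * ennreal (qnorm (signed_sum \<delta> B')))"
    proof (rule mult_left_mono)
      have "h_Rr m v \<le> ennreal (qnorm (signed_sum \<delta> B'))"
        using B B' by (intro h_Rr_le) (auto intro: unimodular_on_subset)
      then show "h_Rr v v \<le> ennreal C' * ennreal (qnorm (signed_sum \<delta> B'))"
        using C'(2)[OF v(2,1,3)] by (meson mult_left_mono order_trans zero_le)
    qed simp
    also have "\<dots> = ennreal (D * C' * qnorm (signed_sum \<delta> B'))"
      using D(1) C'(1) by (simp add: ennreal_mult' mult.assoc)
    finally have "qnorm (signed_sum \<eta> {1..v}) \<le> D * C' * qnorm (signed_sum \<delta> B')"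
      using D(1) C'(1) qnorm_nonneg by (subst (asm) ennreal_le_iff) auto
    also have "\<dots> \<le> D * C' * (Cg * qnorm (signed_sum \<delta> B))"
      using B_le D(1) C'(1) by (intro mult_left_mono) auto
    finally have "Cg * qnorm (signed_sum \<eta> {1..v}) \<le> Cg * (D * C' * (Cg * qnorm (signed_sum \<delta> B)))"
      using Cg_ge_1 by (intro mult_left_mono) auto
    then show ?thesis using A_le by (simp add: K_def mult.assoc)
  qed
  have "qnorm (signed_sum \<epsilon> A) \<le> ((1 + C) * K) * qnorm (signed_sum \<delta> B)"
    if A: "finite A" "A \<subseteq> {1..}" "unimodular_on A \<epsilon>"
      and B: "finite B" "B \<subseteq> {1..}" "unimodular_on B \<delta>"
      and AB: "\<forall>i\<in>A. \<forall>j\<in>B. i < j" and card: "card A \<le> card B" for A B \<epsilon> \<delta>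
  proof -
    define b where "b = qnorm (signed_sum \<delta> B)"
    have b: "b \<ge> 0" by (simp add: b_def qnorm_nonneg)
    show ?thesis
    proof (cases "A = {}")
      case True
      then show ?thesis using C(1) K b by (simp add: b_def)
    next
      case False
      define m u where "m = card A" and "u = Max A"
      have m: "m \<ge> 1" using False A(1) by (simp add: m_def Suc_le_eq card_gt_0_iff)
      have "u \<in> A" using False A(1) by (simp add: u_def)
      have Au: "A \<subseteq> {1..u}" using A by (auto simp: u_def)
      have Bu: "B \<subseteq> {u<..}" using AB \<open>u \<in> A\<close> by auto
      have mu: "m \<le> u" using card_mono[OF _ Au] by (simp add: m_def)
      have "qnorm (signed_sum \<epsilon> A) \<le> max 1 C * (K * b)"
      proof (cases "u \<le> \<psi> m")
        case True
        have "qnorm (signed_sum \<epsilon> A) \<le> K * b"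
          unfolding b_def using m mu card B A Au Bu True by (intro diagonal[of u m]) (auto simp: m_def)
        also have "\<dots> \<le> max 1 C * (K * b)" using K b mult_right_mono[of 1 "max 1 C" "K * b"] by simp
        finally show ?thesis .
      next
        \<comment> \<open>Now \<open>\<psi> m < u\<close>, so \<open>B\<close>, which lies beyond
          \<open>u\<close>, also lies beyond the shorter segment
          \<open>{1..\<psi> m}\<close>.\<close>
        case False
        have \<psi>m: "1 \<le> \<psi> m" using \<psi>[OF m] m by simp
        have "ennreal (qnorm (signed_sum \<epsilon> A)) \<le> h_Rl m u"
          unfolding h_Rl_def using A Au by (intro SUP_upper2[of "(A, \<epsilon>)"]) (auto simp: m_def)
        also have "\<dots> \<le> (SUP u\<in>{m..}. h_Rl m u)" using mu by (intro SUP_upper) auto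
        also have "\<dots> \<le> ennreal C * h_Rl m (\<psi> m)" by (rule C(2)[OF m])
        also have "\<dots> \<le> ennreal C * ennreal (K * b)"
        proof (rule mult_left_mono)
          have "qnorm (signed_sum \<epsilon>' A') \<le> K * b"
            if "A' \<subseteq> {1..\<psi> m}" "unimodular_on A' \<epsilon>'" for A' \<epsilon>'
            unfolding b_def using that m \<psi>m card B Bu False
            by (intro diagonal[of "\<psi> m" m]) (auto simp: m_def)
          then show "h_Rl m (\<psi> m) \<le> ennreal (K * b)"
            unfolding h_Rl_def by (auto intro!: SUP_least ennreal_leI)
        qed simp
        also have "\<dots> = ennreal (C * (K * b))" using C(1) by (simp add: ennreal_mult')
        finally have "qnorm (signed_sum \<epsilon> A) \<le> C * (K * b)"
          using C(1) K b by (subst (asm) ennreal_le_iff) auto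
        also have "\<dots> \<le> max 1 C * (K * b)" using K b by (intro mult_right_mono) auto
        finally show ?thesis .
      qed
      also have "\<dots> \<le> (1 + C) * (K * b)" using K b C(1) by (intro mult_right_mono) auto
      finally show ?thesis by (simp add: b_def mult.assoc)
    qed
  qed
  moreover have "(1 + C) * K \<ge> 0" using C(1) K by simp
  ultimately show ?thesis unfolding superconservative_def by blast
qed

end

section \<open>Part (1) and the passage to a fixed quasi-greedy constant\<close>

context M_basis
begin

lemma PG_embeds_G_if_partially_greedy:
  assumes partially_greedy and q: "q > 0"
  shows "PG_embeds_G q \<omega>"
proof -
  obtain C where C: "C > 0" "\<And>x m. m \<ge> 1 \<Longrightarrow> greedy_error m x \<le> ennreal C * partial_error m x"
    using assms unfolding partially_greedy_def by blast
  \<comment> \<open>The maximum with 1 accounts for the summand \<open>qnorm x\<close>, which occurs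
    in both norms with factor 1.\<close>
  have le: "G_norm q \<omega> x \<le> ennreal (max 1 C) * PG_norm q \<omega> x" for x
  proof -
    have "weighted_lq q \<omega> (\<lambda>n. greedy_error n x) \<le> weighted_lq q \<omega> (\<lambda>n. ennreal C * partial_error n x)"
      by (intro weighted_lq_mono C)
    also have "\<dots> = ennreal C * weighted_lq q \<omega> (\<lambda>n. partial_error n x)"
      by (rule weighted_lq_mult[OF C(1) q])
    also have "\<dots> \<le> ennreal (max 1 C) * weighted_lq q \<omega> (\<lambda>n. partial_error n x)"
      by (intro mult_right_mono ennreal_leI) auto
    finally have "G_norm q \<omega> x
        \<le> ennreal (max 1 C) * ennreal (qnorm x) + ennreal (max 1 C) * weighted_lq q \<omega> (\<lambda>n. partial_error n x)"
      unfolding G_norm_def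
      using mult_right_mono[of 1 "ennreal (max 1 C)" "ennreal (qnorm x)"] ennreal_leI[of 1 "max 1 C"]
      by (intro add_mono) auto
    then show ?thesis by (simp add: PG_norm_def distrib_left)
  qed
  have "G_norm q \<omega> x < top" if "x \<in> PG_class q \<omega>" for x
    using le_less_trans[OF le] that by (simp add: PG_class_def ennreal_mult_less_top)
  then have "PG_class q \<omega> \<subseteq> G_class q \<omega>" by (auto simp: G_class_def)
  then show ?thesis
    unfolding PG_embeds_G_def embeds_def using le by (intro conjI exI[of _ "max 1 C"]) auto
qed

lemma quasi_greedy_basisI:
  assumes quasi_greedy
  obtains Cg where "quasi_greedy_basis scale qnorm e es Cg"
proof -
  obtain C where C: "C > 0" "\<And>x m. m \<ge> 1 \<Longrightarrow> greedy_error m x \<le> ennreal (C * qnorm x)"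
    using assms unfolding quasi_greedy_def by blast
  have "quasi_greedy_basis scale qnorm e es (max 1 C)"
  proof unfold_locales
    fix m x assume "m \<ge> (1::nat)"
    then have "greedy_error m x \<le> ennreal (C * qnorm x)" by (rule C)
    also have "\<dots> \<le> ennreal (max 1 C * qnorm x)"
      using qnorm_nonneg by (intro ennreal_leI mult_right_mono) auto
    finally show "greedy_error m x \<le> ennreal (max 1 C * qnorm x)" .
  qed simp
  then show thesis by (rule that)
qed

end

theorem theorem1p5:
  fixes scale :: "'f::real_normed_field \<Rightarrow> 'a::ab_group_add \<Rightarrow> 'a"
    and qnorm :: "'a \<Rightarrow> real"
    and e :: "nat \<Rightarrow> 'a"
    and es :: "nat \<Rightarrow> 'a \<Rightarrow> 'f"
    and \<omega> :: "nat \<Rightarrow> real"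
  assumes "doubling_weight \<omega>"
    and "lower_dilation_index \<omega> > 0"
    and "M_basis scale qnorm e es"
    and "M_basis.quasi_greedy scale qnorm e es"
  shows "(M_basis.partially_greedy scale qnorm e es \<longrightarrow>
            (\<forall>q>0. M_basis.PG_embeds_G scale qnorm e es q \<omega>)) \<and>
         (M_basis.schauder scale qnorm e es \<and>
            M_basis.property_I scale qnorm e \<and>
            M_basis.property_W_star scale qnorm e \<and>
            (\<exists>q>0. M_basis.PG_embeds_G scale qnorm e es q \<omega>) \<longrightarrow>
          M_basis.partially_greedy scale qnorm e es)"
proof -
  interpret M_basis scale qnorm e es by (rule assms(3))
  obtain Cg where "quasi_greedy_basis scale qnorm e es Cg"
    using assms(4) by (rule quasi_greedy_basisI)
  then interpret quasi_greedy_basis scale qnorm e es Cg .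
  show ?thesis
    using PG_embeds_G_if_partially_greedy partially_greedy_if_superconservative
      superconservative_if_embedding[OF assms(1,2)] by blast
qed

end
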